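(* Let $\Sigma=(\widetilde{\mathbf{x}},\Lambda,\widetilde{B})$ be an acyclic quantum seed with principal coefficients, with indices ordered so that $b_{ij}\ge 0$ for all $n\ge i>j\ge 1$. Let $\mathcal{A}(\Sigma)$ be the associated quantum cluster algebra and let $\mathcal{L}^{(n)}(\Sigma)=\mathbb{ZP}[x_1,x_1^{(n)},\dots,x_n,x_n^{(n)}]$ be the lower bound quantum cluster algebra generated over $\mathbb{ZP}$ by the initial quantum cluster variables $x_1,\dots,x_n$ and the quantum projective cluster variables $x_1^{(n)},\dots,x_n^{(n)}$. Then $$\mathcal{A}(\Sigma)=\mathcal{L}^{(n)}(\Sigma).$$
   Context: Notation: $[s,t]=\{s,s+1,\dots,t\}$; $[x]_+=\max(x,0)$, applied entrywise to vectors; $\mathbf{e}_i$ is the $i$-th unit vector. Quantum seeds. Let $\widetilde{B}=(b_{ij})$ be a $2n\times n$ integer matrix with columns $\mathbf{b}_1,\dots,\mathbf{b}_n$, whose upper $n\times n$ part $B$ is skew-symmetrizable: $DB$ is skew-symmetric for $D=\mathrm{diag}(d_1,\dots,d_n)$ with positive integer $d_j$. "Principal coefficients" means that the lower $n\times n$ part of $\widetilde{B}$ is the identity, i.e. $b_{n+i,j}=\delta_{ij}$. Let $\Lambda=(\lambda_{ij})$ be a skew-symmetric $2n\times 2n$ integer matrix, identified with the bilinear form on $\mathbb{Z}^{2n}$ with $\Lambda(\mathbf{e}_i,\mathbf{e}_j)=\lambda_{ij}$, compatible with $\widetilde{B}$: $\Lambda(\mathbf{b}_j,\mathbf{e}_i)=\delta_{ij}d_j$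 for $i\in[1,2n]$, $j\in[1,n]$. The quantum torus $\mathcal{T}$ is the $\mathbb{Z}[q^{\pm 1/2}]$-algebra with basis $\{X^{\mathbf{a}}:\mathbf{a}\in\mathbb{Z}^{2n}\}$ and product $X^{\mathbf{a}}X^{\mathbf{c}}=q^{\Lambda(\mathbf{a},\mathbf{c})/2}X^{\mathbf{a}+\mathbf{c}}$; $\mathcal{F}$ is its skew-field of fractions and $x_i=X^{\mathbf{e}_i}$, so $x_ix_j=q^{\lambda_{ij}}x_jx_i$ and $X^{\mathbf{a}}=q^{\frac12\sum_{l<k}a_ka_l\lambda_{kl}}x_1^{a_1}\cdots x_{2n}^{a_{2n}}$. The triple $\Sigma=(\widetilde{\mathbf{x}},\Lambda,\widetilde{B})$ with $\widetilde{\mathbf{x}}=\{x_1,\dots,x_{2n}\}$ is a quantum seed; $x_1,\dots,x_n$ are its quantum cluster variables and $x_{n+1},\dots,x_{2n}$ its frozen variables. $\mathbb{ZP}=\mathbb{Z}[q^{\pm1/2}][x_{n+1}^{\pm1},\dots,x_{2n}^{\pm1}]$, a (quasi-commutative) subring of $\mathcal{F}$; $\mathbb{ZP}[y_1,y_2,\dots]$ denotes the subring of $\mathcal{F}$ generated by $\mathbb{ZP}$ and the $y_i$. Mutation. For $k\in[1,n]$, the mutation $\mu_k$ replaces $x_k$ by $x_k'=X^{-\mathbf{e}_k+[\mathbf{b}_k]_+}+X^{-\mathbf{e}_k+[-\mathbf{b}_k]_+}$, replaces $\widetilde{B}$ by $\widetilde{B}'$ with $b'_{ij}=-b_{ij}$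 if $i=k$ or $j=k$, and $b'_{ij}=b_{ij}+\frac{|b_{ik}|b_{kj}+b_{ik}|b_{kj}|}{2}$ otherwise, and replaces $\Lambda$ by the skew-symmetric $\Lambda'$ with $\lambda'_{ij}=\lambda_{ij}$ for $i,j\ne k$ and $\lambda'_{kj}=-\lambda_{kj}+\sum_{t}[b_{tk}]_+\lambda_{tj}$ for $j\neq k$. The same rule applies to any seed obtained by mutation, with $X^{\mathbf{a}}$ formed from the variables and form of that seed by the normalized ordered monomial formula above. The quantum cluster algebra $\mathcal{A}(\Sigma)$ is the $\mathbb{ZP}$-subalgebra of $\mathcal{F}$ generated by all quantum cluster variables of all quantum seeds obtained from $\Sigma$ by finite sequences of mutations. A seed is acyclic if the directed graph on $[1,n]$ with an edge $i\to j$ whenever $b_{ij}>0$ has no oriented cycle; in this case, after reordering, one assumes $b_{ij}\ge0$ for all $i>j$ in $[1,n]$. Projective cluster variables. For $i\in[1,n]$ put $\Sigma^{(i)}=(\widetilde{\mathbf{x}}^{(i)},\Lambda^{(i)},\widetilde{B}^{(i)})=\mu_i\cdots\mu_2\mu_1(\Sigma)$ ($\mu_1$ is applied first), with $\widetilde{\mathbf{x}}^{(i)}=\{x_1^{(i)},\dots,x_{2n}^{(i)}\}$. The elements $x_1^{(n)},\dots,x_n^{(n)}$ of the cluster of $\Sigma^{(n)}$ are the quantum projective cluster variables. *)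

theory Defs
  imports Complex_Main
begin

text \<open>
  Integer vectors and matrices are total functions on \<open>nat\<close>; the meaningful indices are
  \<open>1, \<dots>, m\<close>, and every sum and product below is restricted to them.  A ground division ring
  type \<open>'a\<close> plays the role of the skew-field \<open>\<F>\<close>, and \<open>v \<in> \<F>\<close> that of \<open>q\<^sup>1\<^sup>/\<^sup>2\<close>.
\<close>

definition int_vecs :: "nat \<Rightarrow> (nat \<Rightarrow> int) set" where
  "int_vecs m = {a. \<forall>i. i \<notin> {1..m} \<longrightarrow> a i = 0}"

definition unit_vec :: "nat \<Rightarrow> nat \<Rightarrow> int" where
  "unit_vec i = (\<lambda>j. if j = i then 1 else 0)"

definition bilin :: "nat \<Rightarrow> (nat \<Rightarrow> nat \<Rightarrow> int) \<Rightarrow> (nat \<Rightarrow> int) \<Rightarrow> (nat \<Rightarrow> int) \<Rightarrow> int" where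
  "bilin m \<Lambda> a c = (\<Sum>i\<in>{1..m}. \<Sum>j\<in>{1..m}. a i * c j * \<Lambda> i j)"

definition is_subring :: "'a::ring_1 set \<Rightarrow> bool" where
  "is_subring R \<longleftrightarrow> 0 \<in> R \<and> 1 \<in> R \<and> (\<forall>x\<in>R. \<forall>y\<in>R. x - y \<in> R \<and> x * y \<in> R)"

definition subring_generated :: "'a::ring_1 set \<Rightarrow> 'a set" where
  "subring_generated A = is_subring hull A"

definition laurent_scalars :: "'a::division_ring \<Rightarrow> 'a set" where
  "laurent_scalars v = subring_generated {v, inverse v}"

definition quantum_torus :: "nat \<Rightarrow> 'a::division_ring \<Rightarrow> ((nat \<Rightarrow> int) \<Rightarrow> 'a) \<Rightarrow> 'a set" where
  "quantum_torus m v X =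
     {(\<Sum>a\<in>A. c a * X a) | A c. finite A \<and> A \<subseteq> int_vecs m \<and> c ` A \<subseteq> laurent_scalars v}"

text \<open>
  The type \<open>'a\<close> is a skew-field of fractions of the based quantum torus of rank \<open>m\<close> attached to
  \<open>\<Lambda>\<close>: \<open>v\<close> is an indeterminate over the integers, the \<open>X a\<close> are a basis of the torus over the
  central Laurent polynomial ring in \<open>v\<close>, and every element is a fraction of elements of the
  torus.  Since the torus is an Ore domain, this determines \<open>'a\<close> up to unique isomorphism.
  (\<open>X 0 = 1\<close> follows from \<open>X_mult\<close> and \<open>X_indep\<close>.)
\<close>

locale quantum_torus_skew_field =
  fixes m :: nat and \<Lambda> :: "nat \<Rightarrow> nat \<Rightarrow> int"
    and v :: "'a::division_ring" and X :: "(nat \<Rightarrow> int) \<Rightarrow> 'a"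
  assumes v_indeterminate:
      "\<And>K c. finite K \<Longrightarrow> (\<Sum>k\<in>K. of_int (c k) * v powi k) = 0 \<Longrightarrow> \<forall>k\<in>K. c k = (0::int)"
    and v_central: "\<And>a. a \<in> int_vecs m \<Longrightarrow> v * X a = X a * v"
    and X_mult: "\<And>a c. a \<in> int_vecs m \<Longrightarrow> c \<in> int_vecs m \<Longrightarrow>
                   X a * X c = v powi bilin m \<Lambda> a c * X (\<lambda>i. a i + c i)"
    and X_indep: "\<And>A c. finite A \<Longrightarrow> A \<subseteq> int_vecs m \<Longrightarrow> c ` A \<subseteq> laurent_scalars v \<Longrightarrow>
                   (\<Sum>a\<in>A. c a * X a) = 0 \<Longrightarrow> \<forall>a\<in>A. c a = 0"
    and fractions: "\<And>y. \<exists>p\<in>quantum_torus m v X. \<exists>r\<in>quantum_torus m v X.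
                      r \<noteq> 0 \<and> y = p * inverse r"

text \<open>
  \<open>form\<close> is \<open>\<Lambda>\<close>, of size \<open>2n \<times> 2n\<close>; \<open>exch\<close> is the extended exchange matrix, of size \<open>2n \<times> n\<close>.
\<close>

datatype 'a seed =
  Seed (cvar: "nat \<Rightarrow> 'a") (form: "nat \<Rightarrow> nat \<Rightarrow> int") (exch: "nat \<Rightarrow> nat \<Rightarrow> int")

definition skew_symmetric :: "nat \<Rightarrow> (nat \<Rightarrow> nat \<Rightarrow> int) \<Rightarrow> bool" where
  "skew_symmetric m M \<longleftrightarrow> (\<forall>i\<in>{1..m}. \<forall>j\<in>{1..m}. M i j = - M j i)"

definition skew_symmetrizer :: "nat \<Rightarrow> (nat \<Rightarrow> int) \<Rightarrow> (nat \<Rightarrow> nat \<Rightarrow> int) \<Rightarrow> bool" where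
  "skew_symmetrizer n d B \<longleftrightarrow>
     (\<forall>j\<in>{1..n}. d j > 0) \<and> skew_symmetric n (\<lambda>i j. d i * B i j)"

definition principal_coefficients :: "nat \<Rightarrow> (nat \<Rightarrow> nat \<Rightarrow> int) \<Rightarrow> bool" where
  "principal_coefficients n B \<longleftrightarrow>
     (\<forall>i\<in>{1..n}. \<forall>j\<in>{1..n}. B (n + i) j = (if i = j then 1 else 0))"

definition compatible_pair ::
    "nat \<Rightarrow> (nat \<Rightarrow> int) \<Rightarrow> (nat \<Rightarrow> nat \<Rightarrow> int) \<Rightarrow> (nat \<Rightarrow> nat \<Rightarrow> int) \<Rightarrow> bool" where
  "compatible_pair n d \<Lambda> B \<longleftrightarrow>
     (\<forall>i\<in>{1..2*n}. \<forall>j\<in>{1..n}.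
        bilin (2*n) \<Lambda> (\<lambda>t. B t j) (unit_vec i) = (if i = j then d j else 0))"

text \<open>
  Only for the initial seed: the ambient quantum torus is the one attached to the seed's own form.
  Seeds obtained from it by mutation live in the same skew-field.
\<close>

definition quantum_seed ::
    "nat \<Rightarrow> (nat \<Rightarrow> int) \<Rightarrow> 'a::division_ring \<Rightarrow> ((nat \<Rightarrow> int) \<Rightarrow> 'a) \<Rightarrow> 'a seed \<Rightarrow> bool" where
  "quantum_seed n d v X s \<longleftrightarrow>
     skew_symmetrizer n d (exch s) \<and>
     skew_symmetric (2*n) (form s) \<and>
     compatible_pair n d (form s) (exch s) \<and>
     quantum_torus_skew_field (2*n) (form s) v X \<and>
     (\<forall>i\<in>{1..2*n}. cvar s i = X (unit_vec i))"

definition acyclic_seed :: "nat \<Rightarrow> 'a seed \<Rightarrow> bool" where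
  "acyclic_seed n s \<longleftrightarrow> acyclic {(i, j). i \<in> {1..n} \<and> j \<in> {1..n} \<and> exch s i j > 0}"

text \<open>
  \<open>X\<^sup>a\<close> in an arbitrary seed: the factors do not commute, so the product is taken in increasing
  order of the index.
\<close>

definition seed_monomial ::
    "nat \<Rightarrow> 'a::division_ring \<Rightarrow> 'a seed \<Rightarrow> (nat \<Rightarrow> int) \<Rightarrow> 'a" where
  "seed_monomial n v s a =
     v powi (\<Sum>k\<in>{1..2*n}. \<Sum>l\<in>{1..<k}. a k * a l * form s k l) *
     prod_list (map (\<lambda>i. cvar s i powi a i) [1..<2*n+1])"

definition mutate_form ::
    "nat \<Rightarrow> nat \<Rightarrow> (nat \<Rightarrow> nat \<Rightarrow> int) \<Rightarrow> (nat \<Rightarrow> nat \<Rightarrow> int) \<Rightarrow> nat \<Rightarrow> nat \<Rightarrow> int" where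
  "mutate_form n k B \<Lambda> =
     (let row = (\<lambda>j. - \<Lambda> k j + (\<Sum>t\<in>{1..2*n}. max (B t k) 0 * \<Lambda> t j))
      in (\<lambda>i j. if i = k \<and> j = k then 0
                else if i = k then row j
                else if j = k then - row i
                else \<Lambda> i j))"

text \<open>The numerator below is always even, so \<open>div\<close> is exact.\<close>

definition mutate_exch :: "nat \<Rightarrow> (nat \<Rightarrow> nat \<Rightarrow> int) \<Rightarrow> nat \<Rightarrow> nat \<Rightarrow> int" where
  "mutate_exch k B = (\<lambda>i j.
     if i = k \<or> j = k then - B i j
     else B i j + (\<bar>B i k\<bar> * B k j + B i k * \<bar>B k j\<bar>) div 2)"

definition mutate :: "nat \<Rightarrow> 'a::division_ring \<Rightarrow> nat \<Rightarrow> 'a seed \<Rightarrow> 'a seed" where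
  "mutate n v k s = Seed
     ((cvar s)(k :=
        seed_monomial n v s (\<lambda>i. - unit_vec k i + max (exch s i k) 0) +
        seed_monomial n v s (\<lambda>i. - unit_vec k i + max (- exch s i k) 0)))
     (mutate_form n k (exch s) (form s))
     (mutate_exch k (exch s))"

inductive_set mutation_class :: "nat \<Rightarrow> 'a::division_ring \<Rightarrow> 'a seed \<Rightarrow> 'a seed set"
  for n :: nat and v :: 'a and s :: "'a seed" where
    base: "s \<in> mutation_class n v s"
  | step: "t \<in> mutation_class n v s \<Longrightarrow> k \<in> {1..n} \<Longrightarrow> mutate n v k t \<in> mutation_class n v s"

definition ZP :: "nat \<Rightarrow> 'a::division_ring \<Rightarrow> 'a seed \<Rightarrow> 'a set" where
  "ZP n v s = subring_generated
     ({v, inverse v} \<union> cvar s ` {n+1..2*n} \<union> (\<lambda>i. inverse (cvar s i)) ` {n+1..2*n})"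

definition quantum_cluster_algebra :: "nat \<Rightarrow> 'a::division_ring \<Rightarrow> 'a seed \<Rightarrow> 'a set" where
  "quantum_cluster_algebra n v s =
     subring_generated (ZP n v s \<union> (\<Union>t\<in>mutation_class n v s. cvar t ` {1..n}))"

primrec iterated_seed :: "nat \<Rightarrow> 'a::division_ring \<Rightarrow> 'a seed \<Rightarrow> nat \<Rightarrow> 'a seed" where
  "iterated_seed n v s 0 = s"
| "iterated_seed n v s (Suc i) = mutate n v (Suc i) (iterated_seed n v s i)"

definition projective_variable :: "nat \<Rightarrow> 'a::division_ring \<Rightarrow> 'a seed \<Rightarrow> nat \<Rightarrow> 'a" where
  "projective_variable n v s i = cvar (iterated_seed n v s n) i"

definition lower_bound_algebra :: "nat \<Rightarrow> 'a::division_ring \<Rightarrow> 'a seed \<Rightarrow> 'a set" where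
  "lower_bound_algebra n v s =
     subring_generated (ZP n v s \<union> cvar s ` {1..n} \<union> projective_variable n v s ` {1..n})"

end

theory Submission
  imports Defs
begin

text \<open>
  All gradings are taken inside the skew-field: elements \<open>f\<close> with \<open>z f = v\<^sup>e f z\<close> for distinct
  \<open>e\<close> are linearly independent, because \<open>v\<close> is central of infinite order.  In this way the
  degree in \<open>x\<^sub>k\<close> is the weight for conjugation by \<open>X\<^sup>b\<close>, \<open>b\<close> the \<open>k\<close>-th column of the exchange
  matrix, and no basis of the mutated quantum tori is ever needed.

  Laurent phenomenon: let \<open>T(t)\<close> be the quantum torus of \<open>t\<close> and \<open>U(t)\<close> its intersection with the
  tori of the \<open>n\<close> neighbours of \<open>t\<close>.  If \<open>f\<close> is in \<open>T(t)\<close>, \<open>T(\<mu>\<^sub>j t)\<close> and \<open>T(\<mu>\<^sub>k t)\<close>, then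
  \<open>f x\<^sub>k\<^sup>N\<close> is a polynomial in \<open>x\<^sub>k, x\<^sub>j, x\<^sub>j'\<close>, hence lies in \<open>T(\<mu>\<^sub>j \<mu>\<^sub>k t)\<close>, and \<open>x\<^sub>k\<close>, a sum of
  two terms of distinct weight for \<open>x\<^sub>k'\<close> one of which is a unit, can be cancelled.  So
  \<open>U(\<mu>\<^sub>k t) = U(t)\<close>, and every cluster variable lies in the torus of every seed.

  Lower bound: write \<open>z\<^sub>k\<close> for the projective variables.  They satisfy \<open>z\<^sub>k x\<^sub>k = 1 + V\<close> with \<open>V\<close> a
  monomial in \<open>z\<^sub>i\<close> (\<open>i < k\<close>), \<open>x\<^sub>i\<close> (\<open>i > k\<close>) and \<open>x\<^sub>n\<^sub>+\<^sub>k\<close>.  An element of the tori of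
  \<open>\<Sigma>\<^sup>(\<^sup>0\<^sup>), \<dots>, \<Sigma>\<^sup>(\<^sup>k\<^sup>)\<close> is a polynomial in \<open>x\<^sub>i, z\<^sub>i\<close> (\<open>i \<le> k\<close>) over the remaining invertible
  variables, by induction on \<open>k\<close> and on the order \<open>N\<close> of the pole along \<open>x\<^sub>k\<close>: the lowest coefficient
  is \<open>r z\<^sub>k\<^sup>N x\<^sub>k\<^sup>N\<close>, where the factors \<open>1 + V\<close> can again be cancelled, so that subtracting a multiple
  of \<open>z\<^sub>k\<^sup>N\<close> lowers the pole.
\<close>

section \<open>Subrings and sums of homogeneous elements\<close>

definition add_subgroup :: "'a::ring_1 set \<Rightarrow> bool" where
  "add_subgroup S \<longleftrightarrow> 0 \<in> S \<and> (\<forall>x\<in>S. \<forall>y\<in>S. x - y \<in> S)"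

lemma add_subgroup_add: "add_subgroup S \<Longrightarrow> x \<in> S \<Longrightarrow> y \<in> S \<Longrightarrow> x + y \<in> S"
  unfolding add_subgroup_def by (metis diff_0 diff_minus_eq_add)

lemma add_subgroup_sum:
  "add_subgroup S \<Longrightarrow> (\<And>m. m \<in> A \<Longrightarrow> g m \<in> S) \<Longrightarrow> sum g A \<in> S"
  by (induction A rule: infinite_finite_induct) (auto simp: add_subgroup_add add_subgroup_def)

lemma add_subgroup_Int: "add_subgroup S \<Longrightarrow> add_subgroup T \<Longrightarrow> add_subgroup (S \<inter> T)"
  by (auto simp: add_subgroup_def)

lemma subring_add_subgroup: "is_subring R \<Longrightarrow> add_subgroup R"
  by (auto simp: is_subring_def add_subgroup_def)

lemma
  assumes "is_subring R"
  shows subring_zero: "0 \<in> R" and subring_one: "1 \<in> R"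
    and subring_diff: "x \<in> R \<Longrightarrow> y \<in> R \<Longrightarrow> x - y \<in> R"
    and subring_mult: "x \<in> R \<Longrightarrow> y \<in> R \<Longrightarrow> x * y \<in> R"
    and subring_add: "x \<in> R \<Longrightarrow> y \<in> R \<Longrightarrow> x + y \<in> R"
  using assms add_subgroup_add[OF subring_add_subgroup[OF assms]] by (auto simp: is_subring_def)

lemma subring_power: "is_subring R \<Longrightarrow> x \<in> R \<Longrightarrow> x ^ k \<in> R"
  by (induction k) (auto simp: subring_one subring_mult)

lemma subring_powi:
  fixes R :: "'a::division_ring set"
  assumes "is_subring R" "x \<in> R" "k < 0 \<Longrightarrow> inverse x \<in> R"
  shows "x powi k \<in> R"
  using assms by (simp add: power_int_def subring_power)

lemma subring_Int: "is_subring R \<Longrightarrow> is_subring S \<Longrightarrow> is_subring (R \<inter> S)"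
  by (auto simp: is_subring_def)

lemma subring_generated_subring [simp]: "is_subring (subring_generated G)"
  unfolding subring_generated_def by (rule hull_in) (auto simp: is_subring_def)

lemma subring_generated_superset: "G \<subseteq> subring_generated G"
  unfolding subring_generated_def by (rule hull_subset)

lemma subring_generated_base: "x \<in> G \<Longrightarrow> x \<in> subring_generated G"
  using subring_generated_superset by blast

lemma subring_generated_minimal:
  "G \<subseteq> R \<Longrightarrow> is_subring R \<Longrightarrow> subring_generated G \<subseteq> R"
  unfolding subring_generated_def by (rule hull_minimal)

lemma subring_generated_mono: "G \<subseteq> H \<Longrightarrow> subring_generated G \<subseteq> subring_generated H"
  unfolding subring_generated_def by (rule hull_mono)

text \<open>The sum of the subgroups \<open>H m\<close>, not assumed direct. A decomposition is a
  family indexed by all integers with finite support, so that two decompositions can be compared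
  degree by degree.\<close>

definition hsums :: "(int \<Rightarrow> 'a::ring_1 set) \<Rightarrow> 'a set" where
  "hsums H = {f. \<exists>A g. finite A \<and> (\<forall>m. g m \<in> H m) \<and> (\<forall>m. m \<notin> A \<longrightarrow> g m = 0) \<and> f = sum g A}"

lemma hsumsI:
  assumes "finite A" "\<And>m. m \<in> A \<Longrightarrow> g m \<in> H m" "\<And>m. 0 \<in> H m"
  shows "sum g A \<in> hsums H"
  unfolding hsums_def mem_Collect_eq
  by (intro exI[of _ A] exI[of _ "\<lambda>m. if m \<in> A then g m else 0"]) (use assms in auto)

lemma hsums_base:
  assumes "f \<in> H m" "\<And>m. 0 \<in> H m"
  shows "f \<in> hsums H"
  using hsumsI[of "{m}" "\<lambda>_. f" H] assms by simp

lemma sum_zero_extend: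
  fixes g :: "'b \<Rightarrow> 'a::ring_1"
  assumes "finite A" "finite B" "A \<subseteq> B" "\<And>m. m \<notin> A \<Longrightarrow> g m = 0"
  shows "sum g B = sum g A"
  using assms by (intro sum.mono_neutral_right) auto

lemma hsums_add_subgroup:
  assumes H: "\<And>m. add_subgroup (H m)"
  shows "add_subgroup (hsums H)"
  unfolding add_subgroup_def
proof (intro conjI ballI)
  have Z: "\<And>m. 0 \<in> H m" using H by (auto simp: add_subgroup_def)
  show "0 \<in> hsums H" using hsumsI[of "{}" _ H] Z by simp
  fix x y assume xy: "x \<in> hsums H" "y \<in> hsums H"
  obtain A g where x: "finite A" "\<And>m. g m \<in> H m" "\<And>m. m \<notin> A \<Longrightarrow> g m = 0" "x = sum g A"
    using xy(1) unfolding hsums_def by blast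
  obtain B h where y: "finite B" "\<And>m. h m \<in> H m" "\<And>m. m \<notin> B \<Longrightarrow> h m = 0" "y = sum h B"
    using xy(2) unfolding hsums_def by blast
  have "x - y = sum (\<lambda>m. g m - h m) (A \<union> B)"
    using x y sum_zero_extend[of A "A \<union> B" g] sum_zero_extend[of B "A \<union> B" h]
    by (simp add: sum_subtractf)
  also have "\<dots> \<in> hsums H"
    using x y H by (intro hsumsI) (auto simp: add_subgroup_def)
  finally show "x - y \<in> hsums H" .
qed

lemma hsums_subring:
  assumes H: "\<And>m. add_subgroup (H m)" and one: "1 \<in> H 0"
    and mult: "\<And>a b x y. x \<in> H a \<Longrightarrow> y \<in> H b \<Longrightarrow> x * y \<in> H (a + b)"
  shows "is_subring (hsums H)"
proof -
  have Z: "\<And>m. 0 \<in> H m" using H by (auto simp: add_subgroup_def)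
  note S = hsums_add_subgroup[of H, OF H]
  have "x * y \<in> hsums H" if xy: "x \<in> hsums H" "y \<in> hsums H" for x y
  proof -
    obtain A g where x: "finite A" "\<And>m. g m \<in> H m" "x = sum g A"
      using xy(1) unfolding hsums_def by blast
    obtain B h where y: "finite B" "\<And>m. h m \<in> H m" "y = sum h B"
      using xy(2) unfolding hsums_def by blast
    have "x * y = (\<Sum>a\<in>A. \<Sum>b\<in>B. g a * h b)"
      using x y by (simp add: sum_product)
    also have "\<dots> \<in> hsums H"
      by (intro add_subgroup_sum[OF S]) (use mult x y Z in \<open>blast intro: hsums_base\<close>)
    finally show ?thesis .
  qed
  then show ?thesis
    using S hsums_base[of 1 H 0, OF one] Z unfolding is_subring_def add_subgroup_def by blast
qed

lemma hsums_mono: "(\<And>m. H m \<subseteq> K m) \<Longrightarrow> hsums H \<subseteq> hsums K"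
  unfolding hsums_def by blast

section \<open>Gradings by conjugation\<close>

locale central_parameter =
  fixes v :: "'a::division_ring"
  assumes v_nonzero: "v \<noteq> 0"
    and v_comm: "\<And>y. v * y = y * v"
    and v_infinite_order: "\<And>k. v powi k = 1 \<Longrightarrow> k = 0"
begin

text \<open>Central powers of \<open>v\<close> are kept apart from the other factors: the simp rules
  move them outwards and merge them, so quasi-commutation becomes arithmetic of exponents.\<close>

definition sc :: "int \<Rightarrow> 'a \<Rightarrow> 'a" where
  "sc k y = v powi k * y"

lemma v_power_comm: "v ^ k * y = y * v ^ k"
  by (induction k) (simp_all, metis mult.assoc v_comm)

lemma v_powi_comm: "v powi k * y = y * v powi k"
proof -
  have "inverse (v ^ m) * y = y * inverse (v ^ m)" for m
  proof -
    have "inverse (v ^ m) * y = inverse (v ^ m) * (y * v ^ m) * inverse (v ^ m)"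
      using v_nonzero by (simp add: mult.assoc)
    also have "\<dots> = inverse (v ^ m) * (v ^ m * y) * inverse (v ^ m)"
      by (simp only: v_power_comm)
    also have "\<dots> = y * inverse (v ^ m)"
      using v_nonzero by (simp flip: mult.assoc)
    finally show ?thesis .
  qed
  then show ?thesis by (simp add: power_int_def v_power_comm power_inverse)
qed

lemma sc_mult_left [simp]: "sc k x * y = sc k (x * y)"
  by (simp add: sc_def mult.assoc)

lemma sc_mult_right [simp]: "x * sc k y = sc k (x * y)"
  unfolding sc_def by (metis mult.assoc v_powi_comm)

lemma sc_sc [simp]: "sc k (sc l x) = sc (k + l) x"
  using v_nonzero by (simp add: sc_def power_int_add mult.assoc)

lemma sc_0 [simp]: "sc 0 x = x" and sc_zero [simp]: "sc k 0 = 0"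
  by (auto simp: sc_def)

lemma sc_add: "sc k (x + y) = sc k x + sc k y"
  by (simp add: sc_def distrib_left)

lemma sc_diff: "sc k (x - y) = sc k x - sc k y"
  by (simp add: sc_def right_diff_distrib)

lemma sc_sum: "sc k (sum g A) = (\<Sum>m\<in>A. sc k (g m))"
  by (simp add: sc_def sum_distrib_left)

lemma sc_eq_0 [simp]: "sc k x = 0 \<longleftrightarrow> x = 0"
  using v_nonzero by (simp add: sc_def)

lemma sc_eq_sc_iff: "x \<noteq> 0 \<Longrightarrow> sc k x = sc l x \<longleftrightarrow> k = l"
proof
  assume x: "x \<noteq> 0" and e: "sc k x = sc l x"
  then have "v powi k = v powi l" by (simp add: sc_def)
  moreover have "v powi k = v powi (k - l) * v powi l"
    using v_nonzero by (simp flip: power_int_add)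
  ultimately have "v powi (k - l) = 1" using v_nonzero by simp
  then show "k = l" using v_infinite_order by fastforce
qed simp

lemma sc_in_subring:
  "is_subring R \<Longrightarrow> {v, inverse v} \<subseteq> R \<Longrightarrow> x \<in> R \<Longrightarrow> sc k x \<in> R"
  unfolding sc_def by (intro subring_mult subring_powi) auto

text \<open>For nonzero \<open>z\<close>, the eigenspace of conjugation by \<open>z\<close> with
  eigenvalue \<open>v powi e\<close>. Without an inverse the relation is symmetric in
  \<open>z\<close> and \<open>f\<close> up to the sign of \<open>e\<close>.\<close>

definition Wt :: "'a \<Rightarrow> int \<Rightarrow> 'a set" where
  "Wt z e = {f. z * f = sc e (f * z)}"

lemma Wt_iff: "f \<in> Wt z e \<longleftrightarrow> z * f = sc e (f * z)"
  by (simp add: Wt_def)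

lemma Wt_add_subgroup: "add_subgroup (Wt z e)"
  by (auto simp: add_subgroup_def Wt_def algebra_simps sc_diff)

lemma Wt_mult: "x \<in> Wt z a \<Longrightarrow> y \<in> Wt z b \<Longrightarrow> x * y \<in> Wt z (a + b)"
  unfolding Wt_iff by (metis mult.assoc sc_mult_left sc_mult_right sc_sc)

lemma Wt_sc: "x \<in> Wt z a \<Longrightarrow> sc k x \<in> Wt z a"
  unfolding Wt_iff by (simp add: add.commute)

lemma Wt_one: "1 \<in> Wt z 0"
  by (simp add: Wt_iff)

lemma Wt_scalar: "v \<in> Wt z 0" "inverse v \<in> Wt z 0"
  using v_powi_comm[of 1 z] v_powi_comm[of "-1" z] by (simp_all add: Wt_iff power_int_minus)

lemma Wt_swap: "y \<in> Wt x e \<Longrightarrow> x \<in> Wt y (- e)"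
  by (simp add: Wt_iff)

lemma Wt_inverse:
  assumes "x \<in> Wt z e"
  shows "inverse x \<in> Wt z (- e)"
proof (cases "x = 0")
  case False
  have "inverse x * (z * x) * inverse x = sc e (inverse x * (x * z) * inverse x)"
    using assms unfolding Wt_iff by simp
  then have "inverse x * z = sc e (z * inverse x)" using False
    by (simp add: mult.assoc) (simp flip: mult.assoc)
  then show ?thesis by (simp add: Wt_iff)
qed (simp add: Wt_iff)

lemma Wt_power: "x \<in> Wt z e \<Longrightarrow> x ^ k \<in> Wt z (int k * e)"
  by (induction k) (auto simp: Wt_one algebra_simps intro: Wt_mult)

lemma Wt_powi: "x \<in> Wt z e \<Longrightarrow> x powi k \<in> Wt z (k * e)"
  using Wt_power[of x z e "nat k"] Wt_power[OF Wt_inverse, of x z e "nat (-k)"]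
  by (auto simp: power_int_def)

lemma Wt_power_left: "y \<in> Wt x e \<Longrightarrow> y \<in> Wt (x powi k) (k * e)"
  using Wt_swap[OF Wt_powi[OF Wt_swap, of y x e k]] by simp

text \<open>Eigenvectors with distinct eigenvalues. The weight \<open>\<omega>\<close> is separate
  from the index because the index may be the exponent of a cluster variable, whose weight is a
  multiple of it.\<close>

lemma Wt_independent:
  assumes z: "z \<noteq> 0" and "finite A" "inj_on \<omega> A" "\<And>m. m \<in> A \<Longrightarrow> g m \<in> Wt z (\<omega> m)"
    and "sum g A = 0" "m \<in> A"
  shows "g m = 0"
  using assms(2-)
proof (induction A arbitrary: g m rule: finite_induct)
  case (insert m0 A)
  \<comment> \<open>Conjugation by \<open>z\<close> scales \<open>g m\<close> by
    \<open>v powi \<omega> m\<close>; subtracting \<open>v powi \<omega> m0\<close> times the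
    original relation removes the term \<open>m0\<close>.\<close>
  let ?h = "\<lambda>m. sc (\<omega> m) (g m) - sc (\<omega> m0) (g m)"
  have "sum ?h (insert m0 A) * z = z * sum g (insert m0 A) - sc (\<omega> m0) (sum g (insert m0 A) * z)"
    unfolding sum_distrib_left sum_distrib_right sc_sum sum_subtractf[symmetric]
    by (intro sum.cong) (use insert.prems(2) in \<open>auto simp: left_diff_distrib Wt_iff\<close>)
  then have "sum ?h (insert m0 A) = 0" using insert.prems z by simp
  then have h: "sum ?h A = 0" using insert by simp
  have H: "?h m = 0" if "m \<in> A" for m
    by (rule insert.IH[of ?h, OF _ _ h that])
      (use insert.prems in \<open>auto simp: inj_on_def intro!: Wt_sc
         Wt_add_subgroup[unfolded add_subgroup_def, THEN conjunct2, rule_format]\<close>)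
  have g0: "g m = 0" if "m \<in> A" for m
  proof (rule ccontr)
    assume "g m \<noteq> 0"
    then have "\<omega> m = \<omega> m0" using H[OF that] by (simp add: sc_eq_sc_iff)
    then show False using insert.prems(1) insert.hyps(2) that by (auto simp: inj_on_def)
  qed
  then have "g m0 = 0" using insert.prems(3) insert.hyps by simp
  then show ?case using g0 insert.prems(4) by auto
qed simp

lemma Wt_unique:
  assumes z: "z \<noteq> 0" and inj: "inj \<omega>" and "finite A" "finite B"
    and "\<And>m. g m \<in> Wt z (\<omega> m)" "\<And>m. m \<notin> A \<Longrightarrow> g m = 0"
    and "\<And>m. h m \<in> Wt z (\<omega> m)" "\<And>m. m \<notin> B \<Longrightarrow> h m = 0"
    and "sum g A = sum h B"
  shows "g m = h m"
proof -
  have "sum (\<lambda>m. g m - h m) (A \<union> B) = 0"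
    using assms sum_zero_extend[of A "A \<union> B" g] sum_zero_extend[of B "A \<union> B" h]
    by (simp add: sum_subtractf)
  then have "m \<in> A \<union> B \<Longrightarrow> g m - h m = 0"
    by (intro Wt_independent[OF z, of "A \<union> B" \<omega> "\<lambda>m. g m - h m"])
      (use assms Wt_add_subgroup in \<open>auto simp: add_subgroup_def intro: inj_on_subset\<close>)
  then show ?thesis using assms(6,8) by (cases "m \<in> A \<union> B") auto
qed

text \<open>Weights make decompositions unique, so both decompositions of a common element have the
  same components.\<close>

lemma hsums_Int:
  assumes z: "z \<noteq> 0" and inj: "inj \<omega>"
    and H: "\<And>m. H m \<subseteq> Wt z (\<omega> m)" and K: "\<And>m. K m \<subseteq> Wt z (\<omega> m)"
  shows "hsums H \<inter> hsums K \<subseteq> hsums (\<lambda>m. H m \<inter> K m)"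
proof
  fix f assume f: "f \<in> hsums H \<inter> hsums K"
  obtain A g where x: "finite A" "\<And>m. g m \<in> H m" "\<And>m. m \<notin> A \<Longrightarrow> g m = 0" "f = sum g A"
    using f unfolding hsums_def by blast
  obtain B h where y: "finite B" "\<And>m. h m \<in> K m" "\<And>m. m \<notin> B \<Longrightarrow> h m = 0" "f = sum h B"
    using f unfolding hsums_def by blast
  have "g m = h m" for m
    by (rule Wt_unique[OF z inj, of A B]) (use x y subsetD[OF H] subsetD[OF K] in auto)
  then show "f \<in> hsums (\<lambda>m. H m \<inter> K m)"
    using x y unfolding hsums_def by (auto intro!: exI[of _ A] exI[of _ g])
qed

definition graded :: "'a \<Rightarrow> 'a set \<Rightarrow> bool" where
  "graded z S \<longleftrightarrow> S \<subseteq> hsums (\<lambda>e. S \<inter> Wt z e)"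

lemma graded_Int:
  assumes z: "z \<noteq> 0" and "graded z S" "graded z T"
  shows "graded z (S \<inter> T)"
  using assms(2,3) hsums_Int[OF z inj_on_id, of "\<lambda>e. S \<inter> Wt z e" "\<lambda>e. T \<inter> Wt z e"]
  unfolding graded_def id_def by (fastforce simp: Int_ac)

lemma graded_subring_generated:
  assumes "\<And>y. y \<in> G \<Longrightarrow> \<exists>e. y \<in> Wt z e"
  shows "graded z (subring_generated G)"
  unfolding graded_def
proof (rule subring_generated_minimal)
  have Z: "0 \<in> subring_generated G \<inter> Wt z m" for m
    using Wt_add_subgroup subring_zero[of "subring_generated G"] by (simp add: add_subgroup_def)
  show "G \<subseteq> hsums (\<lambda>e. subring_generated G \<inter> Wt z e)"
    using assms Z by (blast intro: hsums_base subring_generated_base)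
  show "is_subring (hsums (\<lambda>e. subring_generated G \<inter> Wt z e))"
    by (rule hsums_subring)
      (auto intro!: add_subgroup_Int Wt_add_subgroup Wt_mult Wt_one
        subring_mult subring_one intro: subring_add_subgroup)
qed

lemma graded_imp_hsums: "graded z S \<Longrightarrow> S \<subseteq> hsums (Wt z)"
  unfolding graded_def using hsums_mono[of "\<lambda>e. S \<inter> Wt z e" "Wt z"] by blast

text \<open>If \<open>c\<close> is an extremal homogeneous component of \<open>h\<close>, then \<open>c * U\<close> is a component of
  \<open>h * (U + V)\<close>; so the components of \<open>h\<close> are shown to lie in \<open>W\<close> one at a time.\<close>

lemma graded_cancel:
  assumes z: "z \<noteq> 0" and W: "is_subring W" "graded z W"
    and U: "U \<in> W" "inverse U \<in> W" "U \<noteq> 0" "U \<in> Wt z a"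
    and V: "V \<in> W" "V \<in> Wt z b" and ab: "a \<noteq> b"
    and h: "h \<in> hsums (Wt z)" and hW: "h * (U + V) \<in> W"
  shows "h \<in> W"
proof -
  obtain A g where A: "finite A" "\<And>m. g m \<in> Wt z m" "\<And>m. m \<notin> A \<Longrightarrow> g m = 0" "h = sum g A"
    using h unfolding hsums_def by blast
  from A hW show ?thesis
  proof (induction "card A" arbitrary: A g h)
    case 0
    then show ?case using W by (simp add: subring_zero)
  next
    case (Suc c)
    \<comment> \<open>At weight \<open>m0 + a\<close> a product with \<open>V\<close> could only
      come from index \<open>m0 + a - b\<close>, which lies beyond the end of \<open>A\<close> at
      which \<open>m0\<close> sits.\<close>
    define m0 where "m0 = (if a < b then Min A else Max A)"
    have ne: "A \<noteq> {}" using Suc.hyps by auto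
    have m0: "m0 \<in> A" using ne Suc.prems(1) by (simp add: m0_def)
    have g0: "g (m0 + a - b) = 0"
    proof (rule Suc.prems(3), rule)
      assume *: "m0 + a - b \<in> A"
      then have "Min A \<le> m0 + a - b" "m0 + a - b \<le> Max A" using Suc.prems(1) by auto
      then show False using ab by (auto simp: m0_def split: if_splits)
    qed
    obtain B w where B: "finite B" "\<And>m. w m \<in> W \<inter> Wt z m" "\<And>m. m \<notin> B \<Longrightarrow> w m = 0"
      "h * (U + V) = sum w B"
      using subsetD[OF W(2)[unfolded graded_def] Suc.prems(5)] unfolding hsums_def by blast
    \<comment> \<open>All weights that can occur in \<open>h * U\<close> or \<open>h * V\<close>, so
      that both are summed over one index set.\<close>
    define C where "C = (\<lambda>m. m + a) ` A \<union> (\<lambda>m. m + b) ` A"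
    have s: "(\<Sum>p\<in>C. g (p - e) * Y) = h * Y" if e: "e = a \<or> e = b" for e Y
    proof -
      have "(\<Sum>p\<in>C. g (p - e) * Y) = (\<Sum>p\<in>(\<lambda>m. m + e) ` A. g (p - e) * Y)"
        by (rule sum.mono_neutral_right)
          (use Suc.prems(1) e in \<open>auto simp: C_def image_iff intro!: Suc.prems(3)\<close>, force+)
      also have "\<dots> = (\<Sum>m\<in>A. g m * Y)"
        by (subst sum.reindex) (auto simp: inj_on_def)
      finally show ?thesis using Suc.prems(4) by (simp add: sum_distrib_right)
    qed
    have "g (m0 + a - a) * U + g (m0 + a - b) * V = w (m0 + a)"
    proof (rule Wt_unique[OF z, of id C B "\<lambda>p. g (p - a) * U + g (p - b) * V" w])
      show "g (m - a) * U + g (m - b) * V \<in> Wt z (id m)" for m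
        using Wt_mult[OF Suc.prems(2)[of "m - a"] U(4)] Wt_mult[OF Suc.prems(2)[of "m - b"] V(2)]
        by (simp add: add_subgroup_add[OF Wt_add_subgroup])
      show "g (m - a) * U + g (m - b) * V = 0" if "m \<notin> C" for m
        using that Suc.prems(3)[of "m - a"] Suc.prems(3)[of "m - b"]
        by (force simp: C_def image_iff)
      show "(\<Sum>p\<in>C. g (p - a) * U + g (p - b) * V) = sum w B"
        using s[of a U] s[of b V] B(4) by (simp add: sum.distrib distrib_left)
    qed (use B Suc.prems(1) in \<open>auto simp: C_def\<close>)
    then have "g m0 * U \<in> W" using g0 B(2)[of "m0 + a"] by simp
    then have "g m0 * U * inverse U \<in> W" using U(2) W(1) by (blast intro: subring_mult)
    then have gW: "g m0 \<in> W" using U(3) by (simp add: mult.assoc)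
    have "h - g m0 \<in> W"
    proof (rule Suc.hyps(1)[of "A - {m0}" "\<lambda>m. if m = m0 then 0 else g m"])
      show "c = card (A - {m0})" using Suc.hyps(2) Suc.prems(1) m0 by simp
      show "(if m = m0 then 0 else g m) \<in> Wt z m" for m
        using Suc.prems(2) Wt_add_subgroup unfolding add_subgroup_def by presburger
      show "h - g m0 = (\<Sum>m\<in>A - {m0}. if m = m0 then 0 else g m)"
        using Suc.prems(1,4) m0 by (simp add: sum_diff1 sum.If_cases)
      show "(h - g m0) * (U + V) \<in> W"
        using Suc.prems(5) gW U(1) V(1) W(1)
        by (simp add: left_diff_distrib subring_diff subring_mult subring_add)
    qed (use Suc.prems in auto)
    then show ?case using gW W(1) subring_add by fastforce
  qed
qed

section \<open>Skew Laurent extensions\<close>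

text \<open>The degree \<open>m\<close> part of a skew Laurent ring in \<open>x\<close>, with
  coefficients on the left.\<close>

definition rank_one :: "'a set \<Rightarrow> 'a \<Rightarrow> int \<Rightarrow> 'a set" where
  "rank_one R x m = (\<lambda>r. r * x powi m) ` R"

text \<open>Conjugation by \<open>x\<close> respects differences and products and scales each
  generator by a power of \<open>v\<close>. This lets coefficients be moved past powers of
  \<open>x\<close>.\<close>

lemma conj_closed:
  assumes G: "{v, inverse v} \<subseteq> G" "\<And>y. y \<in> G \<Longrightarrow> \<exists>e. y \<in> Wt x e" and x: "x \<noteq> 0"
    and r: "r \<in> subring_generated G"
  shows "x * r * inverse x \<in> subring_generated G"
proof -
  let ?S = "{r. x * r * inverse x \<in> subring_generated G}"
  have "x * y * inverse x \<in> subring_generated G" if "y \<in> G" for y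
  proof -
    obtain e where "x * y = sc e (y * x)" using G(2) \<open>y \<in> G\<close> by (fastforce simp: Wt_iff)
    then have "x * y * inverse x = sc e y" using x by (simp add: mult.assoc)
    then show ?thesis using that G(1)
      by (simp add: sc_in_subring subring_generated_base)
  qed
  moreover have "is_subring ?S"
  proof -
    have mult: "x * (y * w) * inverse x = (x * y * inverse x) * (x * w * inverse x)" for y w
      using x by (simp add: mult.assoc) (simp flip: mult.assoc)
    have diff: "x * (y - w) * inverse x = x * y * inverse x - x * w * inverse x" for y w
      by (simp only: left_diff_distrib right_diff_distrib)
    show ?thesis unfolding is_subring_def mem_Collect_eq Ball_def mult diff
      using x by (auto intro!: subring_mult subring_diff simp: subring_zero subring_one)
  qed
  ultimately have "subring_generated G \<subseteq> ?S" by (intro subring_generated_minimal) auto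
  then show ?thesis using r by auto
qed

lemma powi_conj_closed:
  assumes G: "{v, inverse v} \<subseteq> G" "\<And>y. y \<in> G \<Longrightarrow> \<exists>e. y \<in> Wt x e" and x: "x \<noteq> 0"
    and r: "r \<in> subring_generated G"
  shows "x powi m * r * x powi (- m) \<in> subring_generated G"
  using conj_closed[OF G(1) _ _ r, of "x powi m"] G(2) x Wt_power_left
  by (simp add: power_int_minus) blast

lemma rank_one_mult:
  assumes G: "{v, inverse v} \<subseteq> G" "\<And>y. y \<in> G \<Longrightarrow> \<exists>e. y \<in> Wt x e" and x: "x \<noteq> 0"
    and "f \<in> rank_one (subring_generated G) x a" "g \<in> rank_one (subring_generated G) x b"
  shows "f * g \<in> rank_one (subring_generated G) x (a + b)"
proof -
  obtain r s where r: "r \<in> subring_generated G" "f = r * x powi a"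
    and s: "s \<in> subring_generated G" "g = s * x powi b"
    using assms(4,5) by (auto simp: rank_one_def)
  have "f * g = r * (x powi a * s * x powi (- a)) * x powi (a + b)"
    using x r s by (simp add: power_int_add power_int_minus mult.assoc) (simp flip: mult.assoc)
  then show ?thesis
    unfolding rank_one_def using powi_conj_closed[OF G x s(1)] r(1)
    by (metis imageI subring_generated_subring subring_mult)
qed

lemma rank_one_add_subgroup:
  assumes "is_subring R"
  shows "add_subgroup (rank_one R x m)"
  unfolding add_subgroup_def rank_one_def
proof (intro conjI ballI)
  show "0 \<in> (\<lambda>r. r * x powi m) ` R" using subring_zero[OF assms] by force
  fix f g assume "f \<in> (\<lambda>r. r * x powi m) ` R" "g \<in> (\<lambda>r. r * x powi m) ` R"
  then show "f - g \<in> (\<lambda>r. r * x powi m) ` R"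
    using subring_diff[OF assms] by (auto simp flip: left_diff_distrib)
qed

lemma zero_rank_one: "is_subring R \<Longrightarrow> 0 \<in> rank_one R x m"
  using rank_one_add_subgroup by (auto simp: add_subgroup_def)

lemma rank_one_0: "rank_one R x 0 = R"
  by (auto simp: rank_one_def)

text \<open>Degrees are formal here: independence of the powers of \<open>x\<close> is not claimed.
  It comes later, from an element that gives distinct powers distinct weights.\<close>

lemma laurent_extension:
  assumes G: "{v, inverse v} \<subseteq> G" "\<And>y. y \<in> G \<Longrightarrow> \<exists>e. y \<in> Wt x e" and x: "x \<noteq> 0"
  shows "subring_generated (G \<union> {x, inverse x}) \<subseteq> hsums (rank_one (subring_generated G) x)"
proof (rule subring_generated_minimal)
  let ?H = "rank_one (subring_generated G) x"
  have Z: "0 \<in> ?H m" for m by (simp add: zero_rank_one)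
  have one: "1 \<in> subring_generated G" by (simp add: subring_one)
  show "is_subring (hsums ?H)"
    by (rule hsums_subring) (use rank_one_mult[OF G x] one in \<open>auto simp: rank_one_add_subgroup rank_one_0\<close>)
  have "x \<in> ?H 1" "inverse x \<in> ?H (-1)" using one unfolding rank_one_def by (force simp: power_int_minus)+
  moreover have "y \<in> ?H 0" if "y \<in> G" for y using that by (simp add: rank_one_0 subring_generated_base)
  ultimately show "G \<union> {x, inverse x} \<subseteq> hsums ?H" using Z by (blast intro: hsums_base)
qed

text \<open>Negative degrees receive \<open>{0}\<close>, which keeps the family indexed by the
  integers and comparable with Laurent expansions.\<close>

lemma polynomial_extension:
  assumes G: "{v, inverse v} \<subseteq> G" "\<And>y. y \<in> G \<Longrightarrow> \<exists>e. y \<in> Wt x e" and x: "x \<noteq> 0"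
  shows "subring_generated (insert x G)
    \<subseteq> hsums (\<lambda>m. if m \<ge> 0 then rank_one (subring_generated G) x m else {0})"
proof (rule subring_generated_minimal)
  let ?H = "\<lambda>m. if m \<ge> 0 then rank_one (subring_generated G) x m else {0}"
  have Z: "0 \<in> ?H m" for m by (simp add: zero_rank_one)
  have one: "1 \<in> subring_generated G" by (simp add: subring_one)
  have "add_subgroup {0}" by (simp add: add_subgroup_def)
  then show "is_subring (hsums ?H)"
    by (intro hsums_subring)
      (use rank_one_mult[OF G x] one Z in \<open>auto simp: rank_one_add_subgroup rank_one_0 zero_rank_one split: if_splits\<close>)
  have "x \<in> ?H 1" using one unfolding rank_one_def by force
  moreover have "y \<in> ?H 0" if "y \<in> G" for y using that by (simp add: rank_one_0 subring_generated_base)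
  ultimately show "insert x G \<subseteq> hsums ?H" using Z by (blast intro: hsums_base)
qed

lemma clear_denominators:
  assumes G: "{v, inverse v} \<subseteq> G" "\<And>y. y \<in> G \<Longrightarrow> \<exists>e. y \<in> Wt x e" and x: "x \<noteq> 0"
    and f: "f \<in> subring_generated (G \<union> {x, inverse x})"
  shows "\<exists>N. f * x ^ N \<in> subring_generated (insert x G)"
proof -
  obtain A g where A: "finite A" "\<And>m. g m \<in> rank_one (subring_generated G) x m"
    "f = sum g A" using f laurent_extension[OF G x] unfolding hsums_def by blast
  \<comment> \<open>The largest pole order among the terms; \<open>0\<close> is inserted so that the
    set is nonempty and its maximum nonnegative.\<close>
  let ?N = "nat (Max (insert 0 (uminus ` A)))"
  have "g m * x ^ ?N \<in> subring_generated (insert x G)" if "m \<in> A" for m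
  proof -
    obtain r where r: "r \<in> subring_generated G" "g m = r * x powi m"
      using A(2)[of m] by (auto simp: rank_one_def)
    have "Max (insert 0 (uminus ` A)) \<ge> - m" "Max (insert 0 (uminus ` A)) \<ge> 0"
      using A(1) that by auto
    then have N: "m + int ?N \<ge> 0" by linarith
    have "g m * x ^ ?N = r * x powi (m + int ?N)"
      unfolding r(2) power_int_of_nat[symmetric] using x by (simp only: power_int_add mult.assoc simp_thms)
    also have "\<dots> = r * x ^ nat (m + int ?N)" using N by (simp add: power_int_def)
    also have "\<dots> \<in> subring_generated (insert x G)"
      using r(1) subring_generated_mono[of G "insert x G"]
      by (intro subring_mult subring_power subring_generated_subring) (auto intro: subring_generated_base)
    finally show ?thesis .
  qed
  then have "f * x ^ ?N \<in> subring_generated (insert x G)"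
    unfolding A(3) sum_distrib_right by (intro add_subgroup_sum subring_add_subgroup) auto
  then show ?thesis ..
qed

end

section \<open>Bilinear forms\<close>

text \<open>Agreement of the forms is demanded only on the supports, since a mutated form differs
  from the old one in row and column \<open>k\<close>.\<close>

lemma bilin_cong:
  assumes "\<And>i. i \<in> {1..m} \<Longrightarrow> a i = a' i" "\<And>i. i \<in> {1..m} \<Longrightarrow> c i = c' i"
    and "\<And>i j. i \<in> {1..m} \<Longrightarrow> j \<in> {1..m} \<Longrightarrow> a i \<noteq> 0 \<Longrightarrow> c j \<noteq> 0 \<Longrightarrow> L i j = L' i j"
  shows "bilin m L a c = bilin m L' a' c'"
  unfolding bilin_def using assms by (intro sum.cong refl) (metis mult_zero_left mult_zero_right)

lemma bilin_add_left: "bilin m L (\<lambda>i. a i + b i) c = bilin m L a c + bilin m L b c"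
  and bilin_add_right: "bilin m L a (\<lambda>i. b i + c i) = bilin m L a b + bilin m L a c"
  and bilin_diff_left: "bilin m L (\<lambda>i. a i - b i) c = bilin m L a c - bilin m L b c"
  and bilin_diff_right: "bilin m L a (\<lambda>i. b i - c i) = bilin m L a b - bilin m L a c"
  by (simp_all add: bilin_def sum.distrib sum_subtractf algebra_simps)

lemma bilin_mult_left: "bilin m L (\<lambda>i. k * a i) c = k * bilin m L a c"
  and bilin_mult_right: "bilin m L a (\<lambda>i. k * c i) = k * bilin m L a c"
  and bilin_uminus_left: "bilin m L (\<lambda>i. - a i) c = - bilin m L a c"
  and bilin_uminus_right: "bilin m L a (\<lambda>i. - c i) = - bilin m L a c"
  by (simp_all add: bilin_def sum_distrib_left sum_negf mult_ac)

lemmas bilin_linear = bilin_add_left bilin_add_right bilin_diff_left bilin_diff_right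
  bilin_mult_left bilin_mult_right bilin_uminus_left bilin_uminus_right

lemma bilin_skew:
  assumes "skew_symmetric m L"
  shows "bilin m L a c = - bilin m L c a"
proof -
  have "bilin m L a c = (\<Sum>j\<in>{1..m}. \<Sum>i\<in>{1..m}. a i * c j * L i j)"
    unfolding bilin_def by (rule sum.swap)
  also have "\<dots> = (\<Sum>j\<in>{1..m}. \<Sum>i\<in>{1..m}. - (c j * a i * L j i))"
    using assms unfolding skew_symmetric_def by (intro sum.cong refl) (metis mult.commute mult_minus_right)
  finally show ?thesis by (simp add: bilin_def sum_negf)
qed

lemma bilin_self: "skew_symmetric m L \<Longrightarrow> bilin m L a a = 0"
  using bilin_skew[of m L a a] by simp

lemma sum_unit_vec:
  "finite A \<Longrightarrow> (\<Sum>i\<in>A. unit_vec k i * f i) = (if k \<in> A then f k else 0)"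
  by (simp add: unit_vec_def if_distrib[of "\<lambda>x. x * _"] cong: if_cong)

lemma bilin_unit_left: "k \<in> {1..m} \<Longrightarrow> bilin m L (unit_vec k) c = (\<Sum>j\<in>{1..m}. c j * L k j)"
  unfolding bilin_def by (simp add: mult.assoc sum_unit_vec flip: sum_distrib_left)

lemma bilin_unit_right: "k \<in> {1..m} \<Longrightarrow> bilin m L a (unit_vec k) = (\<Sum>i\<in>{1..m}. a i * L i k)"
  unfolding bilin_def
  by (simp add: mult.assoc mult.left_commute[of "a _"] sum_unit_vec)

lemma bilin_unit_unit: "i \<in> {1..m} \<Longrightarrow> j \<in> {1..m} \<Longrightarrow> bilin m L (unit_vec i) (unit_vec j) = L i j"
  by (simp add: bilin_unit_left sum_unit_vec)

lemma bilin_expand_right: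
  "bilin m L a c = (\<Sum>j\<in>{1..m}. c j * bilin m L a (unit_vec j))"
proof -
  have "bilin m L a c = (\<Sum>j\<in>{1..m}. \<Sum>i\<in>{1..m}. a i * c j * L i j)"
    unfolding bilin_def by (rule sum.swap)
  also have "\<dots> = (\<Sum>j\<in>{1..m}. c j * bilin m L a (unit_vec j))"
    by (intro sum.cong refl) (simp only: bilin_unit_right sum_distrib_left mult_ac)
  finally show ?thesis .
qed

text \<open>Linear extension of compatibility from unit vectors. For monomials it says that the one
  with the \<open>j\<close>-th column as exponent commutes with every variable but x_j.\<close>

lemma compatible_pair_bilin:
  assumes "compatible_pair n d L B" "j \<in> {1..n}"
  shows "bilin (2*n) L (\<lambda>t. B t j) c = d j * c j"
proof -
  have "bilin (2*n) L (\<lambda>t. B t j) c = (\<Sum>i\<in>{1..2*n}. c i * (if i = j then d j else 0))"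
    unfolding bilin_expand_right[of _ _ _ c]
    using assms by (intro sum.cong) (auto simp: compatible_pair_def)
  then show ?thesis using assms(2) by (simp add: if_distrib cong: if_cong)
qed

section \<open>Normalized monomials\<close>

context central_parameter
begin

text \<open>\<open>seed_monomial\<close> with the number of factors as a parameter, for induction on
  the last factor.\<close>

definition pmon :: "nat \<Rightarrow> (nat \<Rightarrow> 'a) \<Rightarrow> (nat \<Rightarrow> nat \<Rightarrow> int) \<Rightarrow> (nat \<Rightarrow> int) \<Rightarrow> 'a" where
  "pmon m x L a = sc (\<Sum>k\<in>{1..m}. \<Sum>l\<in>{1..<k}. a k * a l * L k l)
     (prod_list (map (\<lambda>i. x i powi a i) [1..<m+1]))"

lemma seed_monomial_pmon: "seed_monomial n v t a = pmon (2*n) (cvar t) (form t) a"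
  by (simp add: seed_monomial_def pmon_def sc_def)

lemma pmon_0: "pmon 0 x L a = 1"
  by (simp add: pmon_def)

lemma pmon_Suc:
  "pmon (Suc m) x L a
     = sc (a (Suc m) * (\<Sum>l\<in>{1..m}. a l * L (Suc m) l)) (pmon m x L a * x (Suc m) powi a (Suc m))"
  by (simp add: pmon_def sum_distrib_left mult.assoc atLeastLessThanSuc_atLeastAtMost add.commute)

lemma pmon_weight:
  assumes "\<And>i. i \<in> {1..m} \<Longrightarrow> x i \<in> Wt y (e i)"
  shows "pmon m x L a \<in> Wt y (\<Sum>i\<in>{1..m}. a i * e i)"
  using assms
proof (induction m)
  case (Suc m)
  have "pmon (Suc m) x L a \<in> Wt y ((\<Sum>i\<in>{1..m}. a i * e i) + a (Suc m) * e (Suc m))"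
    unfolding pmon_Suc by (intro Wt_sc Wt_mult Wt_powi Suc.IH) (use Suc.prems in auto)
  then show ?case by simp
qed (simp add: pmon_0 Wt_one)

text \<open>Moving the last factor of the first monomial past the second contributes
  \<open>2 * a (Suc m) * S c\<close>. Its excess over the cross terms in the normalizing exponent of
  the sum is \<open>a (Suc m) * S c - c (Suc m) * S a\<close>, the increment of the form.\<close>

lemma pmon_mult:
  assumes "\<And>i. i \<in> {1..m} \<Longrightarrow> x i \<noteq> 0"
    and "\<And>i j. i \<in> {1..m} \<Longrightarrow> j \<in> {1..m} \<Longrightarrow> x j \<in> Wt (x i) (2 * L i j)"
    and "skew_symmetric m L"
  shows "pmon m x L a * pmon m x L c = sc (bilin m L a c) (pmon m x L (\<lambda>i. a i + c i))"
  using assms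
proof (induction m)
  case 0
  then show ?case by (simp add: pmon_0 bilin_def)
next
  case (Suc m)
  have skew: "L i j = - L j i" if "i \<in> {1..Suc m}" "j \<in> {1..Suc m}" for i j
    using that Suc.prems(3) unfolding skew_symmetric_def by blast
  define S where "S b = (\<Sum>l\<in>{1..m}. b l * L (Suc m) l)" for b
  define y where "y = x (Suc m)"
  have y: "y \<noteq> 0" using Suc.prems(1) by (simp add: y_def)
  have IH: "pmon m x L a * pmon m x L c = sc (bilin m L a c) (pmon m x L (\<lambda>i. a i + c i))"
  proof (rule Suc.IH)
    show "skew_symmetric m L" unfolding skew_symmetric_def by (intro ballI skew) auto
  qed (use Suc.prems(1,2) in auto)
  have "pmon m x L c \<in> Wt y (\<Sum>i\<in>{1..m}. c i * (2 * L (Suc m) i))"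
    unfolding y_def by (rule pmon_weight) (use Suc.prems(2) in auto)
  from Wt_power_left[OF this, of "a (Suc m)"]
  have "pmon m x L c \<in> Wt (y powi a (Suc m)) (a (Suc m) * (2 * S c))"
    by (simp add: S_def sum_distrib_left mult_ac)
  then have swap: "y powi a (Suc m) * (pmon m x L c * z)
      = sc (2 * a (Suc m) * S c) (pmon m x L c * (y powi a (Suc m) * z))" for z
    unfolding Wt_iff mult.assoc[symmetric] by (simp add: mult.assoc mult.left_commute)
  have B: "bilin (Suc m) L a c = bilin m L a c + a (Suc m) * S c - c (Suc m) * S a"
  proof -
    have "bilin (Suc m) L a c
        = bilin m L a c + a (Suc m) * S c + (\<Sum>i\<in>{1..m}. a i * c (Suc m) * L i (Suc m))
          + a (Suc m) * c (Suc m) * L (Suc m) (Suc m)"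
      by (simp add: bilin_def S_def sum.distrib sum_distrib_left algebra_simps)
    moreover have "(\<Sum>i\<in>{1..m}. a i * c (Suc m) * L i (Suc m)) = - (c (Suc m) * S a)"
      unfolding S_def sum_distrib_left sum_negf[symmetric]
      by (intro sum.cong refl) (subst skew, auto)
    moreover have "L (Suc m) (Suc m) = 0" using skew[of "Suc m" "Suc m"] by simp
    ultimately show ?thesis by simp
  qed
  have Sadd: "S (\<lambda>i. a i + c i) = S a + S c"
    by (simp add: S_def sum.distrib algebra_simps)
  have IH': "pmon m x L a * (pmon m x L c * z)
      = sc (bilin m L a c) (pmon m x L (\<lambda>i. a i + c i) * z)" for z
    by (simp add: IH flip: mult.assoc)
  have pw: "y powi p * y powi q = y powi (p + q)" for p q using y by (simp add: power_int_add)
  show ?case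
    unfolding pmon_Suc S_def[symmetric] y_def[symmetric]
    by (simp add: mult.assoc swap IH' pw B Sadd algebra_simps)
qed

lemma pmon_in_subring:
  assumes S: "is_subring S" "{v, inverse v} \<subseteq> S"
    and "\<And>i. i \<in> {1..m} \<Longrightarrow> a i > 0 \<Longrightarrow> x i \<in> S"
    and "\<And>i. i \<in> {1..m} \<Longrightarrow> a i < 0 \<Longrightarrow> inverse (x i) \<in> S"
  shows "pmon m x L a \<in> S"
  using assms(3-)
proof (induction m)
  case (Suc m)
  have "x (Suc m) powi a (Suc m) \<in> S"
    using Suc.prems[of "Suc m"] subring_power[OF S(1)] subring_one[OF S(1)]
    by (cases "a (Suc m)" "0::int" rule: linorder_cases) (auto simp: power_int_def)
  moreover have "pmon m x L a \<in> S" using Suc by auto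
  ultimately show ?case
    unfolding pmon_Suc by (intro sc_in_subring S subring_mult) auto
qed (simp add: pmon_0 subring_one S)

lemma pmon_unit: "k \<ge> 1 \<Longrightarrow> pmon m x L (unit_vec k) = (if k \<le> m then x k else 1)"
proof (induction m)
  case (Suc m)
  have "unit_vec k (Suc m) * (\<Sum>l\<in>{1..m}. unit_vec k l * L (Suc m) l) = 0"
    by (simp add: sum_unit_vec unit_vec_def)
  then show ?case using Suc by (auto simp: pmon_Suc unit_vec_def le_Suc_eq)
qed (simp add: pmon_0)

lemma pmon_zero: "pmon m x L (\<lambda>_. 0) = 1"
  by (induction m) (simp_all add: pmon_0 pmon_Suc)

lemma pmon_cong:
  assumes "\<And>i. i \<in> {1..m} \<Longrightarrow> a i = c i"
    and "\<And>i. i \<in> {1..m} \<Longrightarrow> a i \<noteq> 0 \<Longrightarrow> x i = y i"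
    and "\<And>i j. i \<in> {1..m} \<Longrightarrow> j \<in> {1..m} \<Longrightarrow> a i \<noteq> 0 \<Longrightarrow> a j \<noteq> 0 \<Longrightarrow> L i j = K i j"
  shows "pmon m x L a = pmon m y K c"
  using assms
proof (induction m)
  case (Suc m)
  have "a (Suc m) * (\<Sum>l\<in>{1..m}. a l * L (Suc m) l) = c (Suc m) * (\<Sum>l\<in>{1..m}. c l * K (Suc m) l)"
    unfolding sum_distrib_left
    by (intro sum.cong refl) (use Suc.prems in \<open>metis Suc_leI atLeastAtMost_iff le_SucI mult_eq_0_iff
      le_add1 order_refl plus_1_eq_Suc\<close>)
  moreover have "x (Suc m) powi a (Suc m) = y (Suc m) powi c (Suc m)"
    using Suc.prems(1,2)[of "Suc m"] by (cases "a (Suc m) = 0") auto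
  moreover have "pmon m x L a = pmon m y K c" using Suc by auto
  ultimately show ?case by (simp add: pmon_Suc)
qed (simp add: pmon_0)

end

section \<open>Quantum seeds and their mutations\<close>

locale mutation_setting = central_parameter v for v :: "'a::division_ring" +
  fixes n :: nat and d :: "nat \<Rightarrow> int"
  assumes d_pos: "\<And>j. j \<in> {1..n} \<Longrightarrow> d j > 0"
begin

abbreviation "mon \<equiv> seed_monomial n v"
abbreviation "bil t \<equiv> bilin (2*n) (form t)"

text \<open>This is all that is carried through mutation; no basis of a mutated torus is asserted.
  The factor 2 arises because \<open>v\<close> is the square root of q.\<close>

definition good :: "'a seed \<Rightarrow> bool" where
  "good t \<longleftrightarrow> (\<forall>i\<in>{1..2*n}. cvar t i \<noteq> 0) \<and>
     (\<forall>i\<in>{1..2*n}. \<forall>j\<in>{1..2*n}. cvar t j \<in> Wt (cvar t i) (2 * form t i j)) \<and>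
     skew_symmetric (2*n) (form t) \<and> compatible_pair n d (form t) (exch t)"

text \<open>The exponents of the two exchange monomials at \<open>k\<close>, for \<epsilon> = 1 and
  \<epsilon> = -1. The free sign lets later proofs pick the monomial adapted to another
  column.\<close>

definition mvec :: "'a seed \<Rightarrow> int \<Rightarrow> nat \<Rightarrow> nat \<Rightarrow> int" where
  "mvec t \<epsilon> k = (\<lambda>i. - unit_vec k i + max (\<epsilon> * exch t i k) 0)"

lemma cvar_mutate:
  "cvar (mutate n v k t) k = mon t (mvec t 1 k) + mon t (mvec t (- 1) k)"
  "i \<noteq> k \<Longrightarrow> cvar (mutate n v k t) i = cvar t i"
  by (simp_all add: mutate_def mvec_def)

lemma cvar_mutate_sign:
  "\<epsilon> = 1 \<or> \<epsilon> = - 1 \<Longrightarrow> cvar (mutate n v k t) k = mon t (mvec t \<epsilon> k) + mon t (mvec t (- \<epsilon>) k)"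
  by (auto simp: cvar_mutate add.commute)

lemma form_mutate_off: "i \<noteq> k \<Longrightarrow> j \<noteq> k \<Longrightarrow> form (mutate n v k t) i j = form t i j"
  by (simp add: mutate_def mutate_form_def)

lemma exch_mutate_col: "exch (mutate n v k t) i k = - exch t i k"
  by (simp add: mutate_def mutate_exch_def)

lemma mon_cong:
  assumes "\<And>i. i \<in> {1..2*n} \<Longrightarrow> a i = c i"
    and "\<And>i. i \<in> {1..2*n} \<Longrightarrow> a i \<noteq> 0 \<Longrightarrow> cvar t i = cvar u i"
    and "\<And>i j. i \<in> {1..2*n} \<Longrightarrow> j \<in> {1..2*n} \<Longrightarrow> a i \<noteq> 0 \<Longrightarrow> a j \<noteq> 0 \<Longrightarrow> form t i j = form u i j"
  shows "mon t a = mon u c"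
  unfolding seed_monomial_pmon using assms by (rule pmon_cong)

lemma mon_off:
  assumes "a k = 0"
  shows "mon (mutate n v k t) a = mon t a"
  by (rule mon_cong) (use assms in \<open>metis cvar_mutate(2) form_mutate_off\<close>)+

lemma mon_in_subring:
  assumes "is_subring S" "{v, inverse v} \<subseteq> S"
    and "\<And>i. i \<in> {1..2*n} \<Longrightarrow> a i > 0 \<Longrightarrow> cvar t i \<in> S"
    and "\<And>i. i \<in> {1..2*n} \<Longrightarrow> a i < 0 \<Longrightarrow> inverse (cvar t i) \<in> S"
  shows "mon t a \<in> S"
  unfolding seed_monomial_pmon using assms by (rule pmon_in_subring)

lemma mon_unit: "i \<in> {1..2*n} \<Longrightarrow> mon t (unit_vec i) = cvar t i"
  by (simp add: seed_monomial_pmon pmon_unit)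

lemma mon_zero: "mon t (\<lambda>_. 0) = 1"
  by (simp add: seed_monomial_pmon pmon_zero)

context
  fixes t :: "'a seed"
  assumes good: "good t"
begin

lemma good_nonzero: "i \<in> {1..2*n} \<Longrightarrow> cvar t i \<noteq> 0"
  and good_weight: "i \<in> {1..2*n} \<Longrightarrow> j \<in> {1..2*n} \<Longrightarrow> cvar t j \<in> Wt (cvar t i) (2 * form t i j)"
  and good_skew: "skew_symmetric (2*n) (form t)"
  and good_compatible: "compatible_pair n d (form t) (exch t)"
  using good by (auto simp: good_def)

lemma mon_mult: "mon t a * mon t c = sc (bil t a c) (mon t (\<lambda>i. a i + c i))"
  unfolding seed_monomial_pmon
  by (rule pmon_mult) (auto simp: good_nonzero good_weight good_skew)

lemma mon_nonzero: "mon t a \<noteq> 0"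
  using mon_mult[of a "\<lambda>i. - a i"] mon_zero by auto

lemma mon_weight: "mon t c \<in> Wt (mon t a) (2 * bil t a c)"
  unfolding Wt_iff mon_mult using bilin_skew[OF good_skew, of c a]
  by (simp add: add.commute)

lemma cvar_weight: "i \<in> {1..2*n} \<Longrightarrow> cvar t i \<in> Wt (mon t a) (2 * bil t a (unit_vec i))"
  using mon_weight[of "unit_vec i" a] by (simp add: mon_unit)

lemma mon_weight_cvar: "i \<in> {1..2*n} \<Longrightarrow> mon t a \<in> Wt (cvar t i) (2 * bil t (unit_vec i) a)"
  using mon_weight[of a "unit_vec i"] by (simp add: mon_unit)

lemma mon_power: "mon t a ^ c = mon t (\<lambda>i. int c * a i)"
proof (induction c)
  case (Suc c)
  have "mon t a ^ Suc c = mon t (\<lambda>i. a i + int c * a i)"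
    using Suc by (simp add: mon_mult bilin_linear bilin_self[OF good_skew])
  then show ?case by (simp add: algebra_simps)
qed (simp add: mon_zero)

lemma bil_exch: "j \<in> {1..n} \<Longrightarrow> bil t (\<lambda>i. exch t i j) c = d j * c j"
  using compatible_pair_bilin[OF good_compatible] by simp

text \<open>By compatibility both sides are the pairing of columns \<open>i\<close> and
  \<open>j\<close>, evaluated in the two orders of a skew form.\<close>

lemma exch_symmetrizable: "i \<in> {1..n} \<Longrightarrow> j \<in> {1..n} \<Longrightarrow> d i * exch t i j = - (d j * exch t j i)"
  using bil_exch[of i "\<lambda>l. exch t l j"] bil_exch[of j "\<lambda>l. exch t l i"]
    bilin_skew[OF good_skew, of "\<lambda>l. exch t l i" "\<lambda>l. exch t l j"] by simp

lemma exch_diag: "j \<in> {1..n} \<Longrightarrow> exch t j j = 0"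
  using exch_symmetrizable[of j j] d_pos[of j] by auto

lemma mvec_diff: "mvec t 1 k i - mvec t (- 1) k i = exch t i k"
  by (simp add: mvec_def max_def)

lemma mvec_self: "k \<in> {1..n} \<Longrightarrow> mvec t \<epsilon> k k = - 1"
  by (simp add: mvec_def exch_diag unit_vec_def)

lemma mvec_off: "i \<noteq> k \<Longrightarrow> mvec t \<epsilon> k i = max (\<epsilon> * exch t i k) 0"
  by (simp add: mvec_def unit_vec_def)

lemma bil_mvec_diff:
  assumes "k \<in> {1..n}"
  shows "bil t (mvec t 1 k) c = bil t (mvec t (- 1) k) c + d k * c k"
  using bilin_diff_left[of "2*n" "form t" "mvec t 1 k" "mvec t (- 1) k" c]
  by (simp add: mvec_diff bil_exch[OF assms])

text \<open>The two exponent vectors differ by the \<open>k\<close>-th column, which pairs with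
  \<open>c\<close> to a multiple of \<open>c k\<close>.\<close>

lemma bil_mvec_sign:
  assumes "k \<in> {1..n}" "c k = 0" "\<epsilon> = 1 \<or> \<epsilon> = - 1"
  shows "bil t (mvec t \<epsilon> k) c = bil t (mvec t 1 k) c"
  using assms(3) bil_mvec_diff[OF assms(1), of c] assms(2) by auto

end

end

context central_parameter
begin

text \<open>Applied to the two exchange monomials, whose weights differ, it shows that a mutated
  variable does not vanish.\<close>

lemma Wt_sum_nonzero:
  assumes "z \<noteq> 0" "x \<noteq> 0" "x \<in> Wt z a" "y \<in> Wt z b" "a \<noteq> b"
  shows "x + y \<noteq> 0"
proof
  assume "x + y = 0"
  then have "x = 0 - y" by (simp add: eq_neg_iff_add_eq_0)
  then have "x \<in> Wt z b" using assms(4) Wt_add_subgroup[of z b] unfolding add_subgroup_def by blast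
  then have "sc a (x * z) = sc b (x * z)" using assms(3) by (simp add: Wt_iff)
  then show False using assms by (simp add: sc_eq_sc_iff)
qed

end

context mutation_setting
begin

lemma unit_vec_in: "k \<in> {1..n} \<Longrightarrow> k \<in> {1..2*n}"
  by auto

definition sign :: "int \<Rightarrow> int \<Rightarrow> bool" where
  "sign \<epsilon> c \<longleftrightarrow> (\<epsilon> = 1 \<or> \<epsilon> = - 1) \<and> \<epsilon> * c \<ge> 0"

lemma sign_exists: "\<exists>\<epsilon>. sign \<epsilon> c"
  by (cases "c \<ge> 0") (auto simp: sign_def intro: exI[of _ 1] exI[of _ "-1"])

section \<open>Mutation of a good seed\<close>

context
  fixes t :: "'a seed" and k :: nat
  assumes good: "good t" and k: "k \<in> {1..n}"
begin

abbreviation (input) "t' \<equiv> mutate n v k t"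

lemma form_mutate_row:
  assumes "j \<in> {1..2*n}" "j \<noteq> k"
  shows "form t' k j = bil t (mvec t 1 k) (unit_vec j)"
proof -
  have "form t' k j = - form t k j + (\<Sum>i\<in>{1..2*n}. max (exch t i k) 0 * form t i j)"
    using assms by (simp add: mutate_def mutate_form_def)
  also have "form t k j = (\<Sum>i\<in>{1..2*n}. unit_vec k i * form t i j)"
    using k by (simp add: sum_unit_vec)
  finally show ?thesis
    unfolding bilin_unit_right[OF assms(1)] mvec_def
    by (simp add: sum_subtractf left_diff_distrib)
qed

lemma form_mutate_col: "form t' i k = - form t' k i"
  by (simp add: mutate_def mutate_form_def)

lemma mutate_skew: "skew_symmetric (2*n) (form t')"
  unfolding skew_symmetric_def
proof (intro ballI)
  fix i j assume "i \<in> {1..2*n}" "j \<in> {1..2*n}"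
  then have "form t i j = - form t j i" using good_skew[OF good] unfolding skew_symmetric_def by blast
  then show "form t' i j = - form t' j i"
    using form_mutate_col[of i] form_mutate_col[of j] form_mutate_off[of i k j t] form_mutate_off[of j k i t]
    by (cases "i = k"; cases "j = k"; simp)
qed

lemma bil_mutate_off: "a k = 0 \<Longrightarrow> c k = 0 \<Longrightarrow> bil t' a c = bil t a c"
  by (rule bilin_cong) (auto intro!: form_mutate_off)

text \<open>The new form is the old one with \<open>unit_vec k\<close> replaced by an exchange
  exponent vector; the sign is immaterial when \<open>c k = 0\<close>.\<close>

lemma bil_mutate_row:
  assumes c: "c k = 0" and \<epsilon>: "\<epsilon> = 1 \<or> \<epsilon> = - 1"
  shows "bil t' (unit_vec k) c = bil t (mvec t \<epsilon> k) c"
proof -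
  have "bil t' (unit_vec k) c = (\<Sum>j\<in>{1..2*n}. c j * form t' k j)"
    by (rule bilin_unit_left) (use k in auto)
  also have "\<dots> = (\<Sum>j\<in>{1..2*n}. c j * bil t (mvec t 1 k) (unit_vec j))"
    by (intro sum.cong refl) (use c form_mutate_row in \<open>metis mult_zero_left\<close>)
  also have "\<dots> = bil t (mvec t 1 k) c" by (rule bilin_expand_right[symmetric])
  also have "\<dots> = bil t (mvec t \<epsilon> k) c" using bil_mvec_sign[OF good k, of c \<epsilon>] c \<epsilon> by simp
  finally show ?thesis .
qed

lemma bil_mutate_col:
  assumes "a k = 0" "\<epsilon> = 1 \<or> \<epsilon> = - 1"
  shows "bil t' a (unit_vec k) = bil t a (mvec t \<epsilon> k)"
  using bil_mutate_row[of a \<epsilon>] assms bilin_skew[OF mutate_skew, of a "unit_vec k"]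
    bilin_skew[OF good_skew[OF good], of a "mvec t \<epsilon> k"] by simp

lemma exch_opposite_sign:
  assumes j: "j \<in> {1..n}" and s: "sign \<epsilon> (exch t k j)"
  shows "\<epsilon> * exch t j k \<le> 0"
proof -
  have "d j * (\<epsilon> * exch t j k) = - (d k * (\<epsilon> * exch t k j))"
    using exch_symmetrizable[OF good j k] by (simp add: algebra_simps)
  also have "\<dots> \<le> 0" using s d_pos[OF k] by (simp add: sign_def)
  finally show ?thesis using d_pos[OF j] by (simp add: mult_le_0_iff)
qed

text \<open>Mutation as a change of basis: for a sign \<epsilon> of b_kj, substituting
  \<open>mvec t \<epsilon> k\<close> for \<open>unit_vec k\<close> on the right gives back the old
  column. The bracket vanishes at \<open>k\<close>, where old and new forms disagree.\<close>

lemma exch_mutate: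
  assumes j: "j \<noteq> k" and s: "sign \<epsilon> (exch t k j)"
  shows "exch t' l j = (exch t l j + exch t k j * mvec t \<epsilon> k l) - exch t k j * unit_vec k l"
proof (cases "l = k")
  case True
  then show ?thesis using mvec_self[OF good k] by (simp add: mutate_def mutate_exch_def unit_vec_def)
next
  case False
  let ?b = "exch t l k" and ?c = "exch t k j"
  have "\<bar>?b\<bar> * ?c + ?b * \<bar>?c\<bar> = 2 * (?c * max (\<epsilon> * ?b) 0)"
  proof -
    have "\<bar>?c\<bar> = \<epsilon> * ?c" "\<epsilon> = 1 \<or> \<epsilon> = - 1" using s by (auto simp: sign_def)
    then show ?thesis by (auto simp: max_def abs_if algebra_simps)
  qed
  then have "exch t' l j = exch t l j + ?c * max (\<epsilon> * ?b) 0"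
    using j False by (simp add: mutate_def mutate_exch_def)
  then show ?thesis using False by (simp add: mvec_off[OF good] unit_vec_def)
qed

lemma mutate_compatible: "compatible_pair n d (form t') (exch t')"
  unfolding compatible_pair_def
proof (intro ballI)
  fix i j assume i: "i \<in> {1..2*n}" and j: "j \<in> {1..n}"
  have e0: "bil t' (unit_vec k) (unit_vec k) = 0" by (rule bilin_self[OF mutate_skew])
  have kk: "unit_vec i k = 0" if "i \<noteq> k" using that by (simp add: unit_vec_def)
  show "bil t' (\<lambda>l. exch t' l j) (unit_vec i) = (if i = j then d j else 0)"
  proof (cases "j = k")
    case True
    have b0: "exch t k k = 0" by (rule exch_diag[OF good k])
    have e: "bil t' (\<lambda>l. exch t' l j) (unit_vec i) = - bil t' (\<lambda>l. exch t l k) (unit_vec i)"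
      unfolding True exch_mutate_col by (rule bilin_uminus_left)
    show ?thesis
    proof (cases "i = k")
      case i: True
      have "- bil t' (\<lambda>l. exch t l k) (unit_vec k) = - bil t (\<lambda>l. exch t l k) (mvec t 1 k)"
        using bil_mutate_col[of "\<lambda>l. exch t l k" 1] b0 by simp
      also have "\<dots> = d k" using bil_exch[OF good k, of "mvec t 1 k"] mvec_self[OF good k] by simp
      finally show ?thesis using e i True by simp
    next
      case False
      then have "bil t' (\<lambda>l. exch t l k) (unit_vec i) = d k * unit_vec i k"
        using bil_mutate_off[of "\<lambda>l. exch t l k" "unit_vec i"] b0 kk bil_exch[OF good k] by simp
      then show ?thesis using e False True kk by simp
    qed
  next
    case jk: False
    obtain \<epsilon> where s: "sign \<epsilon> (exch t k j)" using sign_exists by blast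
    then have \<epsilon>: "\<epsilon> = 1 \<or> \<epsilon> = - 1" by (simp add: sign_def)
    define c where "c = exch t k j"
    define w where "w = (\<lambda>l. exch t l j + c * mvec t \<epsilon> k l)"
    have w0: "w k = 0" by (simp add: w_def c_def mvec_self[OF good k])
    have "(\<lambda>l. exch t' l j) = (\<lambda>l. w l - c * unit_vec k l)"
      using exch_mutate[OF jk s] by (simp add: w_def c_def)
    then have e: "bil t' (\<lambda>l. exch t' l j) (unit_vec i)
        = bil t' w (unit_vec i) - c * bil t' (unit_vec k) (unit_vec i)"
      by (simp add: bilin_linear)
    show ?thesis
    proof (cases "i = k")
      case i: True
      have "bil t' w (unit_vec k) = bil t w (mvec t \<epsilon> k)" by (rule bil_mutate_col) (fact w0 \<epsilon>)+
      also have "\<dots> = d j * mvec t \<epsilon> k j"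
        unfolding w_def by (simp add: bilin_linear bilin_self[OF good_skew[OF good]] bil_exch[OF good j])
      \<comment> \<open>With this sign column \<open>k\<close> contributes nothing to
        \<open>mvec\<close> at \<open>j\<close>.\<close>
      also have "\<dots> = 0" using exch_opposite_sign[OF j s] jk by (simp add: mvec_off[OF good])
      finally show ?thesis using e i e0 jk by simp
    next
      case False
      have "bil t' w (unit_vec i) = bil t w (unit_vec i)"
        by (rule bil_mutate_off) (use w0 kk False in auto)
      moreover have "bil t' (unit_vec k) (unit_vec i) = bil t (mvec t \<epsilon> k) (unit_vec i)"
        by (rule bil_mutate_row) (use \<epsilon> kk False in auto)
      ultimately have "bil t' (\<lambda>l. exch t' l j) (unit_vec i) = d j * unit_vec i j"
        using e unfolding w_def by (simp add: bilin_linear bil_exch[OF good j])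
      then show ?thesis by (simp add: unit_vec_def)
    qed
  qed
qed

text \<open>The two sides differ by \<open>2 * d k\<close>; nonvanishing and cancellation of cluster
  variables rest on this gap.\<close>

lemma mvec_weights_differ: "2 * bil t (unit_vec k) (mvec t 1 k) \<noteq> 2 * bil t (unit_vec k) (mvec t (- 1) k)"
  using bil_mvec_diff[OF good k, of "unit_vec k"] d_pos[OF k]
    bilin_skew[OF good_skew[OF good], of "unit_vec k"]
  by (simp add: unit_vec_def)

lemma mutate_cvar_weight:
  assumes "j \<in> {1..2*n}" "j \<noteq> k"
  shows "cvar t' k \<in> Wt (cvar t j) (2 * form t' j k)"
proof -
  have "mon t (mvec t \<epsilon> k) \<in> Wt (cvar t j) (2 * form t' j k)" if \<epsilon>: "\<epsilon> = 1 \<or> \<epsilon> = - 1" for \<epsilon>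
  proof -
    have "bil t (unit_vec j) (mvec t \<epsilon> k) = - bil t (mvec t \<epsilon> k) (unit_vec j)"
      by (rule bilin_skew[OF good_skew[OF good]])
    also have "\<dots> = form t' j k"
      using form_mutate_row[OF assms] form_mutate_col[of j] assms(2) \<epsilon>
        bil_mvec_sign[OF good k, of "unit_vec j" \<epsilon>] by (simp add: unit_vec_def)
    finally show ?thesis using mon_weight_cvar[OF good assms(1), of "mvec t \<epsilon> k"] by simp
  qed
  then show ?thesis unfolding cvar_mutate(1) by (intro add_subgroup_add[OF Wt_add_subgroup]) auto
qed

lemma good_mutate: "good t'"
  unfolding good_def
proof (intro conjI ballI mutate_skew mutate_compatible)
  fix i assume i: "i \<in> {1..2*n}"
  have "mon t (mvec t 1 k) + mon t (mvec t (- 1) k) \<noteq> 0"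
    using Wt_sum_nonzero[OF _ _ mon_weight_cvar[OF good] mon_weight_cvar[OF good] mvec_weights_differ]
      good_nonzero[OF good] mon_nonzero[OF good] unit_vec_in[OF k] by blast
  then show "cvar t' i \<noteq> 0"
    using good_nonzero[OF good i] by (cases "i = k") (auto simp: cvar_mutate)
next
  fix i j assume i: "i \<in> {1..2*n}" and j: "j \<in> {1..2*n}"
  consider "i = k" "j = k" | "i \<noteq> k" "j = k" | "i = k" "j \<noteq> k" | "i \<noteq> k" "j \<noteq> k" by blast
  then show "cvar t' j \<in> Wt (cvar t' i) (2 * form t' i j)"
  proof cases
    case 1
    then show ?thesis using form_mutate_col[of k] by (simp add: Wt_iff)
  next
    case 2
    then show ?thesis using mutate_cvar_weight[OF i] by (simp add: cvar_mutate(2))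
  next
    case 3
    then show ?thesis using Wt_swap[OF mutate_cvar_weight[OF j]] form_mutate_col[of j]
      by (simp add: cvar_mutate(2))
  next
    case 4
    then show ?thesis using good_weight[OF good i j] by (simp add: cvar_mutate(2) form_mutate_off)
  qed
qed

text \<open>For each sign, the exchange monomial formed in \<open>t'\<close> times x_k' equals x_k
  times the one formed in \<open>t\<close>: both are one monomial free of x_k, with equal powers of
  \<open>v\<close>. Add the two equations and cancel x_k'.\<close>

lemma cvar_old: "cvar t k = mon t' (mvec t 1 k) + mon t' (mvec t (- 1) k)"
proof -
  have K: "k \<in> {1..2*n}" by (rule unit_vec_in[OF k])
  note g' = good_mutate
  have e: "mon t' (mvec t \<epsilon> k) * cvar t' k = cvar t k * mon t (mvec t \<epsilon> k)"
    if \<epsilon>: "\<epsilon> = 1 \<or> \<epsilon> = - 1" for \<epsilon>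
  proof -
    define a where "a = (\<lambda>i. mvec t \<epsilon> k i + unit_vec k i)"
    have a0: "a k = 0" by (simp add: a_def mvec_self[OF good k] unit_vec_def)
    have "bil t' (mvec t \<epsilon> k) (unit_vec k) = bil t' a (unit_vec k)"
      by (simp add: a_def bilin_linear bilin_self[OF mutate_skew])
    also have "\<dots> = bil t a (mvec t \<epsilon> k)" by (rule bil_mutate_col) (fact a0 \<epsilon>)+
    also have "\<dots> = bil t (unit_vec k) (mvec t \<epsilon> k)"
      by (simp add: a_def bilin_linear bilin_self[OF good_skew[OF good]])
    finally have b: "bil t' (mvec t \<epsilon> k) (unit_vec k) = bil t (unit_vec k) (mvec t \<epsilon> k)" .
    have "mon t' (mvec t \<epsilon> k) * mon t' (unit_vec k) = sc (bil t' (mvec t \<epsilon> k) (unit_vec k)) (mon t' a)"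
      unfolding mon_mult[OF g'] a_def ..
    moreover have "mon t (unit_vec k) * mon t (mvec t \<epsilon> k) = sc (bil t (unit_vec k) (mvec t \<epsilon> k)) (mon t a)"
      unfolding mon_mult[OF good] a_def by (simp add: add.commute)
    ultimately show ?thesis using mon_off[of a k t] a0 b by (simp add: mon_unit[OF K])
  qed
  have "(mon t' (mvec t 1 k) + mon t' (mvec t (- 1) k)) * cvar t' k = cvar t k * cvar t' k"
    using e[of 1] e[of "-1"] by (simp only: distrib_right) (simp add: cvar_mutate(1) distrib_left)
  then show ?thesis using good_nonzero[OF g' K] by simp
qed

lemma mvec_mutate: "mvec t' \<epsilon> k = mvec t (- \<epsilon>) k"
  by (simp add: mvec_def exch_mutate_col)

end

section \<open>Equality of seeds at the meaningful indices, and involutivity of mutation\<close>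

definition seed_eq :: "'a seed \<Rightarrow> 'a seed \<Rightarrow> bool" where
  "seed_eq t u \<longleftrightarrow> (\<forall>i\<in>{1..2*n}. cvar t i = cvar u i) \<and>
     (\<forall>i\<in>{1..2*n}. \<forall>j\<in>{1..2*n}. form t i j = form u i j) \<and>
     (\<forall>i\<in>{1..2*n}. \<forall>j\<in>{1..n}. exch t i j = exch u i j)"

lemma seed_eq_mutate:
  assumes "seed_eq t u" and k: "k \<in> {1..n}"
  shows "seed_eq (mutate n v k t) (mutate n v k u)"
proof -
  have eq: "cvar t i = cvar u i" "form t i j = form u i j" "l \<in> {1..n} \<Longrightarrow> exch t i l = exch u i l"
    if "i \<in> {1..2*n}" "j \<in> {1..2*n}" for i j l
    using assms(1) that by (auto simp: seed_eq_def)
  have "mon t (mvec t \<epsilon> k) = mon u (mvec u \<epsilon> k)" for \<epsilon>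
    by (rule mon_cong) (use eq k in \<open>auto simp: mvec_def\<close>)
  then have "cvar (mutate n v k t) i = cvar (mutate n v k u) i" if "i \<in> {1..2*n}" for i
    using eq(1)[OF that that] by (cases "i = k") (simp_all add: cvar_mutate)
  moreover have "(\<Sum>l\<in>{1..2*n}. max (exch t l k) 0 * form t l j) = (\<Sum>l\<in>{1..2*n}. max (exch u l k) 0 * form u l j)"
    if "j \<in> {1..2*n}" for j
    by (intro sum.cong refl) (use eq that k in auto)
  ultimately show ?thesis
    using eq k unit_vec_in[OF k] unit_vec_in
    by (simp add: seed_eq_def mutate_def mutate_form_def mutate_exch_def)
qed

lemma mutate_involution:
  assumes good: "good t" and k: "k \<in> {1..n}"
  shows "seed_eq (mutate n v k (mutate n v k t)) t"
proof -
  let ?t = "mutate n v k t"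
  let ?u = "mutate n v k ?t"
  note g = good_mutate[OF good k]
  have "cvar ?u i = cvar t i" for i
    using cvar_old[OF good k] mvec_mutate[OF good k]
    by (cases "i = k") (simp_all add: cvar_mutate add.commute)
  moreover have row: "form ?u k j = form t k j" if j: "j \<in> {1..2*n}" "j \<noteq> k" for j
  proof -
    have u0: "unit_vec j k = 0" using j by (simp add: unit_vec_def)
    have K: "k \<in> {1..2*n}" by (rule unit_vec_in[OF k])
    have e0: "bil t (mvec t (-1) k) (unit_vec j) + bil t (unit_vec k) (unit_vec j)
      = bil t (\<lambda>i. mvec t (-1) k i + unit_vec k i) (unit_vec j)" by (simp add: bilin_linear)
    have "form ?u k j = bil ?t (mvec t (- 1) k) (unit_vec j)"
      using form_mutate_row[OF g k j] mvec_mutate[OF good k] by simp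
    also have "\<dots> = bil ?t (\<lambda>i. mvec t (-1) k i + unit_vec k i) (unit_vec j) - bil ?t (unit_vec k) (unit_vec j)"
      by (simp add: bilin_linear)
    also have "bil ?t (\<lambda>i. mvec t (-1) k i + unit_vec k i) (unit_vec j)
        = bil t (\<lambda>i. mvec t (-1) k i + unit_vec k i) (unit_vec j)"
      by (rule bil_mutate_off[OF good k])
        (use u0 in \<open>auto simp: mvec_self[OF good k], simp add: unit_vec_def\<close>)
    also have "bil ?t (unit_vec k) (unit_vec j) = bil t (mvec t (- 1) k) (unit_vec j)"
      by (rule bil_mutate_row[OF good k]) (use u0 in auto)
    finally show ?thesis using bilin_unit_unit[OF K j(1), of "form t"] e0 by simp
  qed
  moreover have "form ?u i j = form t i j" if ij: "i \<in> {1..2*n}" "j \<in> {1..2*n}" for i j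
  proof -
    have sk: "form t i j = - form t j i" using good_skew[OF good] ij unfolding skew_symmetric_def by blast
    consider "i = k" "j = k" | "i \<noteq> k" "j = k" | "i = k" "j \<noteq> k" | "i \<noteq> k" "j \<noteq> k" by blast
    then show ?thesis
    proof cases
      case 1
      then show ?thesis using sk form_mutate_col[OF g k, of k] by simp
    next
      case 2
      then show ?thesis using sk form_mutate_col[OF g k, of i] row[OF ij(1)] by simp
    next
      case 3
      then show ?thesis using row[OF ij(2)] by simp
    next
      case 4
      then show ?thesis by (simp add: form_mutate_off)
    qed
  qed
  moreover have "exch ?u i j = exch t i j" for i j
  proof (cases "i = k \<or> j = k")
    case True
    then show ?thesis by (auto simp: mutate_def mutate_exch_def)
  next
    case False
    \<comment> \<open>The numerator changes sign under mutation, and \<open>div\<close> commutes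
      with negation because it is even.\<close>
    have "even e \<Longrightarrow> (- e) div 2 = - (e div 2)" for e :: int by presburger
    from this[of "\<bar>exch t i k\<bar> * exch t k j + exch t i k * \<bar>exch t k j\<bar>"]
    show ?thesis using False by (simp add: mutate_def mutate_exch_def)
  qed
  ultimately show ?thesis by (simp add: seed_eq_def)
qed

end

text \<open>Lets powers of a mutated variable be indexed by the negated exponent, in line with the
  weights of the old variable.\<close>

lemma hsums_reflect: "hsums H \<subseteq> hsums (\<lambda>m. H (- m))"
proof
  fix f assume "f \<in> hsums H"
  then obtain A g where A: "finite A" "\<And>m. g m \<in> H m" "\<And>m. m \<notin> A \<Longrightarrow> g m = 0" "f = sum g A"
    unfolding hsums_def by blast
  have "f = sum (\<lambda>m. g (- m)) (uminus ` A)"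
    unfolding A(4) by (subst sum.reindex) (auto simp: inj_on_def)
  moreover have "g (- m) = 0" if "m \<notin> uminus ` A" for m
    using A(3)[of "- m"] that by (metis image_eqI minus_minus)
  ultimately show "f \<in> hsums (\<lambda>m. H (- m))"
    unfolding hsums_def mem_Collect_eq using A(1,2)
    by (intro exI[of _ "uminus ` A"] exI[of _ "\<lambda>m. g (- m)"]) simp
qed

section \<open>The quantum Laurent phenomenon\<close>

context mutation_setting
begin

definition gens :: "'a seed \<Rightarrow> nat set \<Rightarrow> nat set \<Rightarrow> 'a set" where
  "gens t I J = {v, inverse v} \<union> cvar t ` I \<union> (\<lambda>i. inverse (cvar t i)) ` J"

text \<open>Variables and inverses have separate index sets because the lower bound argument uses
  rings in which some variables are not inverted.\<close>

definition LR :: "'a seed \<Rightarrow> nat set \<Rightarrow> nat set \<Rightarrow> 'a set" where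
  "LR t I J = subring_generated (gens t I J)"

abbreviation torus :: "'a seed \<Rightarrow> 'a set" where
  "torus t \<equiv> LR t {1..2*n} {1..2*n}"

lemma LR_subring [simp]: "is_subring (LR t I J)"
  by (simp add: LR_def)

lemma gens_scalars: "{v, inverse v} \<subseteq> gens t I J"
  by (simp add: gens_def)

lemma gens_LR: "gens t I J \<subseteq> LR t I J"
  unfolding LR_def by (rule subring_generated_superset)

lemma LR_scalars: "{v, inverse v} \<subseteq> LR t I J"
  using gens_LR gens_scalars by blast

lemma cvar_LR: "i \<in> I \<Longrightarrow> cvar t i \<in> LR t I J"
  and inverse_cvar_LR: "i \<in> J \<Longrightarrow> inverse (cvar t i) \<in> LR t I J"
  using gens_LR[of t I J] by (auto simp: gens_def)

lemma LR_mono: "I \<subseteq> I' \<Longrightarrow> J \<subseteq> J' \<Longrightarrow> LR t I J \<subseteq> LR t I' J'"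
  unfolding LR_def by (rule subring_generated_mono) (auto simp: gens_def)

lemma sc_LR: "x \<in> LR t I J \<Longrightarrow> sc e x \<in> LR t I J"
  by (rule sc_in_subring) (auto simp: LR_scalars[unfolded insert_subset])

lemma gens_cong: "(\<And>i. i \<in> I \<union> J \<Longrightarrow> cvar t i = cvar u i) \<Longrightarrow> gens t I J = gens u I J"
  unfolding gens_def by (metis (no_types, lifting) UnI1 UnI2 image_cong)

lemma gens_mutate: "k \<notin> I \<Longrightarrow> k \<notin> J \<Longrightarrow> gens (mutate n v k t) I J = gens t I J"
  by (rule gens_cong) (metis Un_iff cvar_mutate(2))

lemma mon_LR:
  assumes "\<And>i. i \<in> {1..2*n} \<Longrightarrow> a i > 0 \<Longrightarrow> i \<in> I" "\<And>i. i \<in> {1..2*n} \<Longrightarrow> a i < 0 \<Longrightarrow> i \<in> J"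
  shows "mon t a \<in> LR t I J"
  by (rule mon_in_subring) (use assms LR_scalars[of t I J] in \<open>auto intro: cvar_LR inverse_cvar_LR\<close>)

lemma mon_torus: "mon t a \<in> torus t"
  by (rule mon_LR) auto

lemma gens_insert_both:
  "gens t (insert k I) (insert k J) = gens t I J \<union> {cvar t k, inverse (cvar t k)}"
  by (auto simp: gens_def)

lemma gens_insert: "gens t (insert k I) J = insert (cvar t k) (gens t I J)"
  by (auto simp: gens_def)

lemma gens_weight:
  assumes g: "good t" and IJ: "I \<subseteq> {1..2*n}" "J \<subseteq> {1..2*n}" and y: "y \<in> gens t I J"
  shows "\<exists>e. y \<in> Wt (mon t a) e"
proof -
  consider "y = v" | "y = inverse v" | i where "i \<in> {1..2*n}" "y = cvar t i"
    | i where "i \<in> {1..2*n}" "y = inverse (cvar t i)"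
    using y IJ by (auto simp: gens_def)
  then show ?thesis using cvar_weight[OF g] Wt_inverse Wt_scalar by cases blast+
qed

lemma gens_weight_cvar:
  assumes "good t" "I \<subseteq> {1..2*n}" "J \<subseteq> {1..2*n}" "y \<in> gens t I J" "k \<in> {1..2*n}"
  shows "\<exists>e. y \<in> Wt (cvar t k) e"
  using gens_weight[OF assms(1-4), of "unit_vec k"] mon_unit[OF assms(5)] by simp

lemma graded_LR:
  assumes "good t" "I \<subseteq> {1..2*n}" "J \<subseteq> {1..2*n}"
  shows "graded (mon t a) (LR t I J)"
  unfolding LR_def by (rule graded_subring_generated) (rule gens_weight[OF assms])

lemma graded_LR_cvar:
  assumes "good t" "I \<subseteq> {1..2*n}" "J \<subseteq> {1..2*n}" "k \<in> {1..2*n}"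
  shows "graded (cvar t k) (LR t I J)"
  using graded_LR[OF assms(1-3), of "unit_vec k"] mon_unit[OF assms(4)] by simp

lemma mon_inverse: "good t \<Longrightarrow> inverse (mon t a) = mon t (\<lambda>i. - a i)"
  using mon_mult[of t "\<lambda>i. - a i" a]
  by (intro inverse_unique) (simp add: mon_mult bilin_linear bilin_self good_skew mon_zero)

text \<open>Conjugation by \<open>X\<^sup>b\<close>, where \<open>b\<close> is the \<open>k\<close>-th column of the exchange matrix, fixes every
  variable except \<open>x\<^sub>k\<close> and scales \<open>x\<^sub>k\<close> and \<open>x\<^sub>k'\<close> by opposite powers of \<open>v\<close>.\<close>

lemma exchange_Int:
  assumes g: "good t" and k: "k \<in> {1..n}" and IJ: "I \<subseteq> {1..2*n} - {k}" "J \<subseteq> {1..2*n} - {k}"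
    and H: "\<And>m. H m \<subseteq> rank_one (LR t I J) (cvar t k) m"
    and H': "\<And>m. H' m \<subseteq> rank_one (LR t I J) (cvar (mutate n v k t) k) (- m)"
  shows "hsums H \<inter> hsums H' \<subseteq> hsums (\<lambda>m. H m \<inter> H' m)"
proof -
  let ?t = "mutate n v k t" let ?x = "cvar t k" let ?y = "cvar ?t k"
  define z where "z = mon t (\<lambda>i. exch t i k)"
  have K: "k \<in> {1..2*n}" by (rule unit_vec_in[OF k])
  have z: "z \<noteq> 0" by (simp add: z_def mon_nonzero[OF g])
  have w0: "cvar t i \<in> Wt z 0" if "i \<in> {1..2*n}" "i \<noteq> k" for i
    using cvar_weight[OF g that(1), of "\<lambda>i. exch t i k"] that(2)
    unfolding bil_exch[OF g k] by (simp add: z_def unit_vec_def)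
  have x: "?x \<in> Wt z (2 * d k)"
    using cvar_weight[OF g K, of "\<lambda>i. exch t i k"]
    unfolding bil_exch[OF g k] by (simp add: z_def unit_vec_def)
  have "mon t (mvec t \<epsilon> k) \<in> Wt z (- 2 * d k)" for \<epsilon>
    using mon_weight[OF g, of "mvec t \<epsilon> k" "\<lambda>i. exch t i k"]
    unfolding bil_exch[OF g k] mvec_self[OF g k] by (simp add: z_def)
  then have y: "?y \<in> Wt z (- 2 * d k)"
    unfolding cvar_mutate(1) by (intro add_subgroup_add[OF Wt_add_subgroup])
  have "is_subring (Wt z 0)"
    using Wt_add_subgroup[of z 0] Wt_one Wt_mult[of _ z 0 _ 0]
    by (simp add: is_subring_def add_subgroup_def)
  moreover have "cvar t i \<in> Wt z 0 \<and> inverse (cvar t i) \<in> Wt z 0" if "i \<in> I \<union> J" for i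
  proof -
    have "i \<in> {1..2*n}" "i \<noteq> k" using that IJ by blast+
    from w0[OF this] Wt_inverse[OF w0[OF this]] show ?thesis by simp
  qed
  then have "gens t I J \<subseteq> Wt z 0"
    using Wt_scalar by (auto simp: gens_def)
  ultimately have R: "LR t I J \<subseteq> Wt z 0"
    unfolding LR_def by (intro subring_generated_minimal)
  \<comment> \<open>The \<open>m\<close>-th power of x_k and the power \<open>- m\<close> of the
    mutated variable have the same weight.\<close>
  have Rx: "rank_one (LR t I J) ?x m \<subseteq> Wt z (2 * d k * m)" for m
    using Wt_mult[OF subsetD[OF R] Wt_powi[OF x, of m]] by (auto simp: rank_one_def algebra_simps)
  have Ry: "rank_one (LR t I J) ?y (- m) \<subseteq> Wt z (2 * d k * m)" for m
    using Wt_mult[OF subsetD[OF R] Wt_powi[OF y, of "- m"]] by (auto simp: rank_one_def algebra_simps)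
  have "inj (\<lambda>m. 2 * d k * m)" using d_pos[OF k] by (auto simp: inj_on_def)
  then show ?thesis
    by (rule hsums_Int[OF z]) (use H H' Rx Ry in \<open>blast+\<close>)
qed

lemma mutated_decomposition:
  assumes g: "good t" and k: "k \<in> {1..n}" and IJ: "I \<subseteq> {1..2*n} - {k}" "J \<subseteq> {1..2*n} - {k}"
    and f: "f \<in> LR (mutate n v k t) (insert k I) (insert k J)"
  shows "f \<in> hsums (\<lambda>m. rank_one (LR t I J) (cvar (mutate n v k t) k) (- m))"
proof -
  let ?t = "mutate n v k t" let ?y = "cvar ?t k"
  have K: "k \<in> {1..2*n}" by (rule unit_vec_in[OF k])
  have IJ': "I \<subseteq> {1..2*n}" "J \<subseteq> {1..2*n}" "k \<notin> I" "k \<notin> J" using IJ by auto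
  note g' = good_mutate[OF g k]
  have "f \<in> hsums (rank_one (LR t I J) ?y)"
    using f laurent_extension[OF gens_scalars gens_weight_cvar[OF g' IJ'(1,2) _ K] good_nonzero[OF g' K]]
    unfolding LR_def gens_insert_both gens_mutate[OF IJ'(3,4)] by blast
  then show ?thesis using hsums_reflect by blast
qed

lemma exchange_decomposition:
  assumes g: "good t" and k: "k \<in> {1..n}" and IJ: "I \<subseteq> {1..2*n} - {k}" "J \<subseteq> {1..2*n} - {k}"
    and f: "f \<in> LR t (insert k I) (insert k J)" "f \<in> LR (mutate n v k t) (insert k I) (insert k J)"
  shows "f \<in> hsums (\<lambda>m. rank_one (LR t I J) (cvar t k) m
    \<inter> rank_one (LR t I J) (cvar (mutate n v k t) k) (- m))"
proof -
  have K: "k \<in> {1..2*n}" by (rule unit_vec_in[OF k])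
  have IJ': "I \<subseteq> {1..2*n}" "J \<subseteq> {1..2*n}" using IJ by auto
  have "f \<in> hsums (rank_one (LR t I J) (cvar t k))"
    using f(1) laurent_extension[OF gens_scalars gens_weight_cvar[OF g IJ' _ K] good_nonzero[OF g K]]
    unfolding LR_def gens_insert_both by blast
  from IntI[OF this mutated_decomposition[OF g k IJ f(2)]] show ?thesis
    by (rule subsetD[OF exchange_Int[OF g k IJ order_refl order_refl]])
qed

lemma old_cvar_torus:
  assumes "good t" "k \<in> {1..n}" "i \<in> {1..2*n}"
  shows "cvar t i \<in> torus (mutate n v k t)"
proof (cases "i = k")
  case True
  show ?thesis unfolding True cvar_old[OF assms(1,2)] by (intro subring_add LR_subring mon_torus)
next
  case False
  then show ?thesis using cvar_LR[OF assms(3), of "mutate n v k t"] by (simp add: cvar_mutate(2))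
qed

lemma cvar_old_sign:
  assumes "good t" "k \<in> {1..n}" "sign \<epsilon> c"
  shows "cvar t k = mon (mutate n v k t) (mvec t \<epsilon> k) + mon (mutate n v k t) (mvec t (- \<epsilon>) k)"
  using cvar_old[OF assms(1,2)] assms(3) by (auto simp: sign_def add.commute)

section \<open>The Laurent property across two mutations\<close>

context
  fixes t :: "'a seed" and j k :: nat
  assumes good: "good t" and k: "k \<in> {1..n}" and j: "j \<in> {1..n}" and jk: "j \<noteq> k"
begin

abbreviation (input) "t1 \<equiv> mutate n v k t"
abbreviation (input) "t2 \<equiv> mutate n v j (mutate n v k t)"

lemma good1: "good t1" and good2: "good t2"
  using good_mutate good k j by blast+

text \<open>The variables of \<open>t1\<close> other than x_j are variables of \<open>t2\<close>,
  hence units of its torus; x_j is a sum of two monomials there, so its exponent must be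
  nonnegative.\<close>

lemma mon_torus2:
  assumes "a j \<ge> 0"
  shows "mon t1 a \<in> torus t2"
proof (rule mon_in_subring)
  show "cvar t1 i \<in> torus t2" if "i \<in> {1..2*n}" for i
    by (rule old_cvar_torus[OF good1 j that])
  fix i assume "i \<in> {1..2*n}" "a i < 0"
  then show "inverse (cvar t1 i) \<in> torus t2"
    using assms inverse_cvar_LR[of i "{1..2*n}" t2] by (cases "i = j") (auto simp: cvar_mutate(2))
qed (auto simp: LR_scalars[unfolded insert_subset])

lemma cvar_j_torus2: "cvar t j \<in> torus t2"
  using old_cvar_torus[OF good1 j, of j] unit_vec_in[OF j] jk by (simp add: cvar_mutate(2))

lemma mvec_k_nonneg: "mvec t \<epsilon> k j \<ge> 0"
  by (simp add: mvec_off[OF good] jk)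

lemma cvar_k_torus2: "cvar t k \<in> torus t2"
  unfolding cvar_old[OF good k] by (intro subring_add LR_subring mon_torus2 mvec_k_nonneg)

lemma mvec_k_sign:
  assumes "sign \<epsilon> (exch t k j)"
  shows "mvec t \<epsilon> k j = 0"
  using exch_opposite_sign[OF good k j assms] by (simp add: mvec_off[OF good] jk)

text \<open>Mutate \<open>t1\<close> back at \<open>k\<close>: by involutivity this vector then
  stands for the old unit vector.\<close>

lemma bil_mutate_mvec:
  assumes "a k = 0" "\<epsilon> = 1 \<or> \<epsilon> = - 1"
  shows "bil t1 a (mvec t \<epsilon> k) = bil t a (unit_vec k)"
proof -
  have "bil t1 a (mvec t \<epsilon> k) = bil (mutate n v k t1) a (unit_vec k)"
    using bil_mutate_col[OF good1 k, of a "- \<epsilon>"] assms mvec_mutate[OF good k, of "- \<epsilon>"] by auto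
  also have "\<dots> = bil t a (unit_vec k)"
    using mutate_involution[OF good k] by (intro bilin_cong refl) (auto simp: seed_eq_def)
  finally show ?thesis .
qed

text \<open>Expanding \<open>x\<^sub>k = U + V\<close>, where only \<open>V\<close> involves \<open>x\<^sub>j\<close>.\<close>

lemma cvar_k_power:
  assumes s: "sign \<epsilon> (exch t k j)" and nz: "exch t k j \<noteq> 0"
  shows "\<exists>h\<in>torus t2. cvar t k ^ p = mon t1 (mvec t \<epsilon> k) ^ p + cvar t j * h"
proof (induction p)
  case 0
  then show ?case by (intro bexI[of _ 0]) (auto simp: subring_zero)
next
  case (Suc p)
  define U where "U = mon t1 (mvec t \<epsilon> k)"
  define V where "V = mon t1 (mvec t (- \<epsilon>) k)"
  define a where "a = (\<lambda>i. mvec t (- \<epsilon>) k i - unit_vec j i)"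
  have J: "j \<in> {1..2*n}" by (rule unit_vec_in[OF j])
  have xj: "mon t1 (unit_vec j) = cvar t j" by (simp add: mon_unit[OF J] cvar_mutate(2) jk)
  obtain h where h: "h \<in> torus t2" "cvar t k ^ p = U ^ p + cvar t j * h"
    using Suc.IH unfolding U_def by blast
  have "exch t j k \<noteq> 0"
    using exch_symmetrizable[OF good j k] nz d_pos[OF k] by auto
  \<comment> \<open>The entries b_jk and b_kj have opposite signs, so x_j has positive exponent in
    \<open>V\<close> and can be split off, leaving \<open>a\<close> nonnegative at
    \<open>j\<close>.\<close>
  then have "mvec t (- \<epsilon>) k j \<ge> 1"
    using exch_opposite_sign[OF good k j s] s by (auto simp: sign_def mvec_off[OF good] jk)
  then have aT: "mon t1 a \<in> torus t2"
    by (intro mon_torus2) (simp add: a_def unit_vec_def)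
  obtain e where V: "V = sc e (cvar t j * mon t1 a)"
  proof
    show "V = sc (- bil t1 (unit_vec j) a) (cvar t j * mon t1 a)"
      unfolding xj[symmetric] mon_mult[OF good1] by (simp add: V_def a_def)
  qed
  obtain e' where "U ^ p * cvar t j = sc e' (cvar t j * U ^ p)"
    using mon_weight[OF good1, of "unit_vec j"] unfolding xj U_def mon_power[OF good1] Wt_iff by blast
  then have "U ^ p * (cvar t j * y) = sc e' (cvar t j * (U ^ p * y))" for y
    by (simp flip: mult.assoc)
  then have UV: "U ^ p * V = cvar t j * sc (e + e') (U ^ p * mon t1 a)"
    unfolding V by simp
  have UT: "U \<in> torus t2" "V \<in> torus t2"
    unfolding U_def V_def by (intro mon_torus2 mvec_k_nonneg)+
  have "cvar t k ^ Suc p = cvar t k ^ p * (U + V)"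
    unfolding U_def V_def power_Suc2 using cvar_old_sign[OF good k s] by simp
  also have "\<dots> = U ^ Suc p + cvar t j * (sc (e + e') (U ^ p * mon t1 a) + h * (U + V))"
    unfolding h(2) distrib_left distrib_right UV power_Suc2 by (simp add: mult.assoc add_ac)
  finally show ?case
    unfolding U_def[symmetric] using h(1) aT UT
    by (blast intro: sc_LR subring_add subring_mult subring_power LR_subring)
qed

text \<open>For a sign \<epsilon> of b_kj, x_k occurs in at most one of the two exchange monomials,
  to the power \<open>p\<close>. Write x_k^p as U^p plus x_j times some \<open>h\<close>. The second
  part is harmless, as x_j cancels the exponent -1 of \<open>a\<close>; the first part and the other
  exchange monomial add up to a power of \<open>v\<close> times the monomial of \<gamma> times the
  variable \<open>cvar t2 j\<close>, where \<gamma> vanishes at \<open>j\<close>.\<close>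

lemma mutated_cvar_torus2: "cvar (mutate n v j t) j \<in> torus t2"
proof -
  obtain \<epsilon> where s: "sign \<epsilon> (exch t k j)" using sign_exists by blast
  then have \<epsilon>: "\<epsilon> = 1 \<or> \<epsilon> = - 1" by (simp add: sign_def)
  define c where "c = exch t k j"
  define p where "p = nat \<bar>c\<bar>"
  have p: "int p = \<epsilon> * c" using s by (auto simp: sign_def p_def c_def)
  have J: "j \<in> {1..2*n}" "k \<in> {1..2*n}" using unit_vec_in j k by auto
  have xj: "mon t1 (unit_vec j) = cvar t j" by (simp add: mon_unit[OF J(1)] cvar_mutate(2) jk)
  define \<beta> where "\<beta> = mvec t (- \<epsilon>) j"
  define b where "b = (\<lambda>l. exch t1 l j)"
  define a where "a = (\<lambda>i. mvec t \<epsilon> j i - int p * unit_vec k i)"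
  define \<gamma> where "\<gamma> = (\<lambda>i. \<beta> i - mvec t1 (- \<epsilon>) j i)"
  define U where "U = mon t1 (mvec t \<epsilon> k)"
  have mj: "mvec t \<epsilon> j i - mvec t (- \<epsilon>) j i = \<epsilon> * exch t i j"
       "mvec t1 \<epsilon> j i - mvec t1 (- \<epsilon>) j i = \<epsilon> * exch t1 i j" for i
    using \<epsilon> mvec_diff[OF good, of j i] mvec_diff[OF good1, of j i] by auto
  have \<beta>k: "\<beta> k = 0" and ak: "a k = 0"
    using p s jk unfolding \<beta>_def a_def sign_def c_def
    by (auto simp: mvec_off[OF good] unit_vec_def)
  have aj: "a j = - 1"
    by (simp add: a_def mvec_self[OF good j] unit_vec_def jk)
  have \<gamma>j: "\<gamma> j = 0"
    by (simp add: \<gamma>_def \<beta>_def mvec_self[OF good j] mvec_self[OF good1 j])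
  have split: "mon t (mvec t \<epsilon> j) = sc (- (int p * bil t a (unit_vec k))) (mon t1 a * cvar t k ^ p)"
  proof -
    have "mon t a * cvar t k ^ p = sc (int p * bil t a (unit_vec k)) (mon t (mvec t \<epsilon> j))"
      unfolding mon_unit[OF J(2), of t, symmetric] mon_power[OF good] mon_mult[OF good]
      by (simp add: a_def bilin_linear right_diff_distrib)
    then show ?thesis using mon_off[of a k t] ak by simp
  qed
  obtain h where h: "h \<in> torus t2" "cvar t k ^ p = U ^ p + cvar t j * h"
  proof (cases "c = 0")
    case True
    then show ?thesis using that[of 0] by (simp add: p_def subring_zero)
  next
    case False
    then show ?thesis using that cvar_k_power[OF s] unfolding U_def c_def by blast
  qed
  have "mon t1 a * cvar t j = sc (bil t1 a (unit_vec j)) (mon t1 (\<lambda>i. a i + unit_vec j i))"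
    unfolding xj[symmetric] mon_mult[OF good1] ..
  moreover have "mon t1 (\<lambda>i. a i + unit_vec j i) \<in> torus t2"
    by (rule mon_torus2) (simp add: aj unit_vec_def)
  ultimately have "mon t1 a * cvar t j \<in> torus t2" by (simp add: sc_LR)
  then have rest: "mon t1 a * (cvar t j * h) \<in> torus t2"
    unfolding mult.assoc[symmetric] using h(1) by (rule subring_mult[OF LR_subring])
  have "mon t1 a * U ^ p = sc (int p * bil t a (unit_vec k)) (mon t1 (\<lambda>i. a i + int p * mvec t \<epsilon> k i))"
    unfolding U_def mon_power[OF good1] mon_mult[OF good1]
    using bil_mutate_mvec[of a \<epsilon>] ak \<epsilon> by (simp add: bilin_linear)
  moreover have "a i + int p * mvec t \<epsilon> k i = \<gamma> i + mvec t1 \<epsilon> j i" for i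
    using mj[of i] exch_mutate[OF good k jk s, of i] \<epsilon> unfolding a_def \<gamma>_def \<beta>_def p c_def
    by (auto simp: algebra_simps)
  ultimately have lead: "sc (- (int p * bil t a (unit_vec k))) (mon t1 a * U ^ p) = mon t1 (\<lambda>i. \<gamma> i + mvec t1 \<epsilon> j i)"
    by simp
  have low: "mon t (mvec t (- \<epsilon>) j) = mon t1 (\<lambda>i. \<gamma> i + mvec t1 (- \<epsilon>) j i)"
    using mon_off[of \<beta> k t] \<beta>k by (simp add: \<beta>_def \<gamma>_def)
  define e where "e = bil t1 \<gamma> (mvec t1 1 j)"
  \<comment> \<open>As \<gamma> vanishes at \<open>j\<close>, it pairs equally with both exchange
    exponents of \<open>t1\<close> at \<open>j\<close>, so both terms acquire the same power of
    \<open>v\<close>.\<close>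
  have e: "bil t1 \<gamma> (mvec t1 \<sigma> j) = e" if "\<sigma> = 1 \<or> \<sigma> = - 1" for \<sigma>
    using bil_mvec_sign[of t1 j \<gamma> \<sigma>, OF good1 j] \<gamma>j that
      bilin_skew[OF good_skew[OF good1], of \<gamma>] unfolding e_def by auto
  have "mon t1 \<gamma> * cvar t2 j
      = sc e (mon t1 (\<lambda>i. \<gamma> i + mvec t1 \<epsilon> j i) + mon t1 (\<lambda>i. \<gamma> i + mvec t1 (- \<epsilon>) j i))"
    using e[of \<epsilon>] e[of "- \<epsilon>"] \<epsilon>
    unfolding cvar_mutate_sign[OF \<epsilon>, of j t1] distrib_left mon_mult[OF good1] sc_add by auto
  moreover have "mon t1 \<gamma> * cvar t2 j \<in> torus t2"
    using mon_torus2[of \<gamma>] \<gamma>j cvar_LR[OF J(1), of t2 "{1..2*n}"] by (intro subring_mult) auto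
  ultimately have "sc (- e) (sc e (mon t1 (\<lambda>i. \<gamma> i + mvec t1 \<epsilon> j i) + mon t1 (\<lambda>i. \<gamma> i + mvec t1 (- \<epsilon>) j i)))
      \<in> torus t2" by (metis sc_LR)
  then have main: "mon t1 (\<lambda>i. \<gamma> i + mvec t1 \<epsilon> j i) + mon t1 (\<lambda>i. \<gamma> i + mvec t1 (- \<epsilon>) j i) \<in> torus t2"
    by simp
  have "cvar (mutate n v j t) j
      = (mon t1 (\<lambda>i. \<gamma> i + mvec t1 \<epsilon> j i) + mon t1 (\<lambda>i. \<gamma> i + mvec t1 (- \<epsilon>) j i))
        + sc (- (int p * bil t a (unit_vec k))) (mon t1 a * (cvar t j * h))"
    unfolding cvar_mutate_sign[OF \<epsilon>, of j t] split low h(2) distrib_left sc_add lead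
    by (simp add: add_ac)
  then show ?thesis using main sc_LR[OF rest] by (simp add: subring_add)
qed

text \<open>x_k = U + V, with the sign chosen so that \<open>U\<close> does not involve x_j and is a
  unit in both tori; \<open>U\<close> and \<open>V\<close> have different weights for
  \<open>cvar t1 k\<close>. One factor is cancelled at a time.\<close>

lemma cancel_cvar_k:
  assumes "f \<in> torus t1" "f * cvar t k ^ N \<in> torus t2"
  shows "f \<in> torus t2"
  using assms
proof (induction N arbitrary: f)
  case (Suc N)
  have J: "j \<in> {1..2*n}" "k \<in> {1..2*n}" using unit_vec_in j k by auto
  have xk: "cvar t k \<in> torus t1" by (rule old_cvar_torus[OF good k J(2)])
  have fx: "f * cvar t k \<in> torus t2"
    by (rule Suc.IH) (use Suc.prems xk in \<open>auto simp: subring_mult mult.assoc\<close>)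
  obtain \<epsilon> where s: "sign \<epsilon> (exch t k j)" using sign_exists by blast
  then have \<epsilon>: "\<epsilon> = 1 \<or> \<epsilon> = - 1" by (simp add: sign_def)
  define z where "z = cvar t1 k"
  define U where "U = mon t1 (mvec t \<epsilon> k)"
  define V where "V = mon t1 (mvec t (- \<epsilon>) k)"
  let ?W = "torus t1 \<inter> torus t2"
  have x: "cvar t k = U + V" unfolding U_def V_def by (rule cvar_old_sign[OF good k s])
  have z2: "z = cvar t2 k" using jk by (simp add: z_def cvar_mutate(2))
  have g1: "graded z (torus t1)" "graded z (torus t2)"
    using graded_LR_cvar[OF good1 order_refl order_refl J(2)]
      graded_LR_cvar[OF good2 order_refl order_refl J(2)] z2 by (simp_all add: z_def)
  have z: "z \<noteq> 0" unfolding z_def by (rule good_nonzero[OF good1 J(2)])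
  have "f \<in> ?W"
  proof (rule graded_cancel[OF z])
    show "is_subring ?W" by (simp add: subring_Int)
    show "graded z ?W" by (rule graded_Int[OF z g1])
    show "U \<in> ?W" "V \<in> ?W"
      unfolding U_def V_def using mon_torus mon_torus2 mvec_k_nonneg by blast+
    show "inverse U \<in> ?W"
      unfolding U_def mon_inverse[OF good1]
      using mon_torus mon_torus2[of "\<lambda>i. - mvec t \<epsilon> k i"] mvec_k_sign[OF s] by simp
    show "U \<noteq> 0" by (simp add: U_def mon_nonzero[OF good1])
    show "U \<in> Wt z (2 * bil t1 (unit_vec k) (mvec t \<epsilon> k))"
      "V \<in> Wt z (2 * bil t1 (unit_vec k) (mvec t (- \<epsilon>) k))"
      unfolding U_def V_def z_def by (rule mon_weight_cvar[OF good1 J(2)])+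
    show "2 * bil t1 (unit_vec k) (mvec t \<epsilon> k) \<noteq> 2 * bil t1 (unit_vec k) (mvec t (- \<epsilon>) k)"
      using mvec_weights_differ[OF good1 k] \<epsilon> mvec_mutate[OF good k] by auto
    show "f \<in> hsums (Wt z)" using Suc.prems(1) graded_imp_hsums[OF g1(1)] by blast
    show "f * (U + V) \<in> ?W" using fx Suc.prems(1) xk x by (auto intro: subring_mult)
  qed
  then show ?case by simp
qed simp

lemma laurent_step:
  assumes "f \<in> torus t" "f \<in> torus (mutate n v j t)" "f \<in> torus t1"
  shows "f \<in> torus t2"
proof -
  let ?u = "mutate n v j t"
  have J: "j \<in> {1..2*n}" "k \<in> {1..2*n}" using unit_vec_in j k by auto
  note gu = good_mutate[OF good j]
  define I where "I = {1..2*n} - {j, k}"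
  define G where "G = gens t I I \<union> {cvar t j, cvar ?u j}"
  define Q where "Q = subring_generated (G \<union> {cvar t k, inverse (cvar t k)})"
  have Q: "is_subring Q" by (simp add: Q_def)
  have Ij: "{1..2*n} - {j} = insert k I" and I: "I \<subseteq> {1..2*n}" using J jk by (auto simp: I_def)
  define H where "H = (\<lambda>m. rank_one (LR t ({1..2*n} - {j}) ({1..2*n} - {j})) (cvar t j) m
    \<inter> rank_one (LR t ({1..2*n} - {j}) ({1..2*n} - {j})) (cvar ?u j) (- m))"
  have "f \<in> hsums H" unfolding H_def
    by (rule exchange_decomposition[OF good j order_refl order_refl])
      (simp_all only: insert_Diff[OF J(1)] assms(1,2))
  then obtain A g where A: "finite A" "f = sum g A" "\<And>m. g m \<in> H m"
    unfolding hsums_def by blast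
  have RQ: "LR t ({1..2*n} - {j}) ({1..2*n} - {j}) \<subseteq> Q"
    unfolding Ij LR_def Q_def gens_insert_both by (rule subring_generated_mono) (auto simp: G_def)
  have xQ: "cvar t j \<in> Q" "cvar ?u j \<in> Q" by (auto simp: Q_def G_def intro!: subring_generated_base)
  \<comment> \<open>Nonnegative degrees are written with x_j and negative ones with its mutation, so
    neither has to be inverted.\<close>
  have "g m \<in> Q" for m
  proof (cases "m \<ge> 0")
    case True
    obtain r where "r \<in> Q" "g m = r * cvar t j powi m"
      using A(3)[of m] RQ unfolding H_def rank_one_def by blast
    then show ?thesis using True by (auto intro!: subring_mult subring_powi Q xQ)
  next
    case False
    obtain r where "r \<in> Q" "g m = r * cvar ?u j powi (- m)"
      using A(3)[of m] RQ unfolding H_def rank_one_def by blast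
    then show ?thesis using False by (auto intro!: subring_mult subring_powi Q xQ)
  qed
  then have "f \<in> Q" unfolding A(2) by (intro add_subgroup_sum subring_add_subgroup Q)
  moreover have Gs: "{v, inverse v} \<subseteq> G" using gens_scalars by (auto simp: G_def)
  moreover have Gw: "\<exists>e. y \<in> Wt (cvar t k) e" if "y \<in> G" for y
    using that gens_weight_cvar[OF good I I _ J(2)] good_weight[OF good J(2,1)]
      good_weight[OF gu J(2,1)] jk unfolding G_def by (auto simp: cvar_mutate(2))
  ultimately obtain N where "f * cvar t k ^ N \<in> subring_generated (insert (cvar t k) G)"
    using clear_denominators[OF Gs Gw good_nonzero[OF good J(2)]] unfolding Q_def by blast
  moreover have "subring_generated (insert (cvar t k) G) \<subseteq> torus t2"
  proof (rule subring_generated_minimal)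
    have "gens t I I = gens t2 I I"
      by (rule gens_cong) (auto simp: I_def cvar_mutate(2))
    then have "gens t I I \<subseteq> torus t2" using gens_LR[of t2 I I] LR_mono[OF I I] by auto
    then show "insert (cvar t k) G \<subseteq> torus t2"
      using cvar_k_torus2 cvar_j_torus2 mutated_cvar_torus2 by (auto simp: G_def)
  qed simp
  ultimately show ?thesis using cancel_cvar_k[OF assms(3)] by blast
qed

end

section \<open>Upper bounds and their invariance under mutation\<close>

definition upper :: "'a seed \<Rightarrow> 'a set" where
  "upper t = torus t \<inter> (\<Inter>k\<in>{1..n}. torus (mutate n v k t))"

lemma torus_cong: "seed_eq t u \<Longrightarrow> torus t = torus u"
  unfolding LR_def seed_eq_def by (rule arg_cong[OF gens_cong]) auto

lemma upper_cong: "seed_eq t u \<Longrightarrow> upper t = upper u"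
  unfolding upper_def by (intro arg_cong2[of _ _ _ _ "(\<inter>)"] INF_cong torus_cong seed_eq_mutate refl)

lemma upper_mutate_subset:
  assumes g: "good t" and k: "k \<in> {1..n}"
  shows "upper t \<subseteq> upper (mutate n v k t)"
proof
  fix f assume f: "f \<in> upper t"
  have "f \<in> torus (mutate n v j (mutate n v k t))" if "j \<in> {1..n}" for j
    using f laurent_step[OF g k that] torus_cong[OF mutate_involution[OF g k]] k that
    by (cases "j = k") (auto simp: upper_def)
  then show "f \<in> upper (mutate n v k t)" using f k by (auto simp: upper_def)
qed

lemma upper_mutate:
  assumes g: "good t" and k: "k \<in> {1..n}"
  shows "upper (mutate n v k t) = upper t"
  using upper_mutate_subset[OF g k] upper_mutate_subset[OF good_mutate[OF g k] k]
    upper_cong[OF mutate_involution[OF g k]] by blast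

lemma mutation_class_upper:
  assumes "good s" "t \<in> mutation_class n v s"
  shows "good t \<and> upper t = upper s"
  using assms(2) by induction (use assms(1) good_mutate upper_mutate in auto)

lemma cvar_upper:
  assumes "good t" "i \<in> {1..2*n}"
  shows "cvar t i \<in> upper t"
  using old_cvar_torus[OF assms(1) _ assms(2)] cvar_LR[OF assms(2)] by (auto simp: upper_def)

end

section \<open>Projective cluster variables\<close>

locale projective_setting = mutation_setting v n d
  for v :: "'a::division_ring" and n :: nat and d :: "nat \<Rightarrow> int" +
  fixes s :: "'a seed"
  assumes good_initial: "good s"
    and principal: "principal_coefficients n (exch s)"
    and exch_nonneg: "\<And>i j. i \<in> {1..n} \<Longrightarrow> j \<in> {1..n} \<Longrightarrow> i > j \<Longrightarrow> exch s i j \<ge> 0"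
begin

abbreviation "\<sigma> \<equiv> iterated_seed n v s"
abbreviation "x \<equiv> cvar s"

text \<open>The variable created by the \<open>l\<close>-th mutation. For \<open>l\<close> in
  \<open>{1..n}\<close> later mutations keep it, so it is the projective variable of index
  \<open>l\<close>.\<close>

definition z :: "nat \<Rightarrow> 'a" where
  "z l = cvar (\<sigma> l) l"

text \<open>The sign that row and column \<open>l\<close> have acquired after the first
  \<open>i\<close> mutations.\<close>

definition flip :: "nat \<Rightarrow> nat \<Rightarrow> int" where
  "flip i l = (if l \<le> i then - 1 else 1)"

lemma good_iterated: "i \<le> n \<Longrightarrow> good (\<sigma> i)"
  by (induction i) (auto simp: good_initial good_mutate)

lemma iterated_in_class: "i \<le> n \<Longrightarrow> \<sigma> i \<in> mutation_class n v s"
  by (induction i) (auto intro: mutation_class.intros)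

lemma cvar_iterated: "cvar (\<sigma> i) l = (if 1 \<le> l \<and> l \<le> i then z l else x l)"
proof (induction i)
  case (Suc i)
  show ?case
  proof (cases "l = Suc i")
    case True
    then show ?thesis by (simp add: z_def)
  next
    case False
    have "cvar (\<sigma> (Suc i)) l = cvar (\<sigma> i) l"
      using False cvar_mutate(2) by simp
    then show ?thesis using Suc False by auto
  qed
qed auto

text \<open>Each mutation happens at a source or sink, so the exchange matrix only changes signs.\<close>

lemma exch_initial_sign:
  assumes i: "i < n" and l: "l \<in> {1..2*n}"
  shows "flip i l * exch s l (Suc i) \<ge> 0"
proof -
  have K: "Suc i \<in> {1..n}" using i by auto
  consider "l \<le> i" | "l = Suc i" | "l > Suc i" "l \<le> n" | "l > n" by linarith
  then show ?thesis
  proof cases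
    case 1
    then have l': "l \<in> {1..n}" using l i by auto
    have "d l * exch s l (Suc i) = - (d (Suc i) * exch s (Suc i) l)"
      by (rule exch_symmetrizable[OF good_initial l' K])
    also have "\<dots> \<le> 0" using exch_nonneg[OF K l'] d_pos[OF K] 1 by simp
    finally show ?thesis using d_pos[OF l'] 1 by (simp add: flip_def mult_le_0_iff)
  next
    case 2
    then show ?thesis using exch_diag[OF good_initial K] by simp
  next
    case 3
    then show ?thesis using exch_nonneg[of l "Suc i"] i by (simp add: flip_def)
  next
    case 4
    define r where "r = l - n"
    have r: "l = n + r" "r \<in> {1..n}" using 4 l by (auto simp: r_def)
    then have "exch s l (Suc i) = (if r = Suc i then 1 else 0)"
      using principal K unfolding principal_coefficients_def by blast
    then show ?thesis using 4 i by (simp add: flip_def)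
  qed
qed

lemma exch_iterated:
  assumes "i \<le> n" "l \<in> {1..2*n}" "j \<in> {1..n}"
  shows "exch (\<sigma> i) l j = flip i l * flip i j * exch s l j"
  using assms
proof (induction i arbitrary: l j)
  case 0
  then show ?case by (simp add: flip_def)
next
  case (Suc i)
  let ?K = "Suc i"
  have i: "i < n" and K: "?K \<in> {1..n}" using Suc.prems by auto
  note g = good_iterated[OF less_imp_le[OF i]]
  have col: "exch (\<sigma> i) m ?K \<ge> 0" if "m \<in> {1..2*n}" for m
    using Suc.IH[OF _ that K] exch_initial_sign[OF i that] i by (simp add: flip_def)
  show ?case
  proof (cases "j = ?K")
    case True
    have "exch (\<sigma> ?K) l j = - exch (\<sigma> i) l j" unfolding True by (simp add: exch_mutate_col)
    then show ?thesis using Suc.IH[of l j] Suc.prems exch_diag[OF good_initial K] True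
      by (cases "l = ?K") (auto simp: flip_def)
  next
    case False
    have j': "j \<in> {1..2*n}" by (rule unit_vec_in[OF Suc.prems(3)])
    have "d ?K * exch (\<sigma> i) ?K j = - (d j * exch (\<sigma> i) j ?K)"
      by (rule exch_symmetrizable[OF g K Suc.prems(3)])
    also have "\<dots> \<le> 0" using col[OF j'] d_pos[OF Suc.prems(3)] by simp
    finally have "exch (\<sigma> i) ?K j \<le> 0" using d_pos[OF K] by (simp add: mult_le_0_iff)
    \<comment> \<open>Column \<open>?K\<close> is nonnegative, so with sign -1 \<open>mvec\<close>
      is minus the unit vector and only row \<open>?K\<close> changes.\<close>
    then have s: "sign (- 1) (exch (\<sigma> i) ?K j)" by (simp add: sign_def)
    have "exch (\<sigma> ?K) l j = exch (\<sigma> i) l j - 2 * exch (\<sigma> i) ?K j * unit_vec ?K l"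
      using exch_mutate[OF g K False s, of l] col[OF Suc.prems(2)]
      by (simp add: mvec_def algebra_simps)
    then show ?thesis using Suc.IH[of l j] Suc.prems False
      by (cases "l = ?K") (auto simp: flip_def unit_vec_def)
  qed
qed

lemma exch_iterated_nonneg:
  assumes "i < n" "l \<in> {1..2*n}"
  shows "exch (\<sigma> i) l (Suc i) \<ge> 0"
  using exch_iterated[of i l "Suc i"] exch_initial_sign[OF assms] assms by (simp add: flip_def)

text \<open>As the column is nonnegative, one exchange monomial is the bare inverse of the mutated
  variable, the origin of the summand 1 in 1 + V.\<close>

lemma mvec_iterated:
  assumes "i < n" "l \<in> {1..2*n}"
  shows "mvec (\<sigma> i) (- 1) (Suc i) l = - unit_vec (Suc i) l"
    and "mvec (\<sigma> i) 1 (Suc i) l = exch (\<sigma> i) l (Suc i) - unit_vec (Suc i) l"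
  using exch_iterated_nonneg[OF assms] by (auto simp: mvec_def)

text \<open>\<open>P\<close> collects initial variables that are not inverted.  They must be allowed because clearing
  the pole along \<open>x\<^sub>k\<^sub>+\<^sub>1\<close> leads back to the statement for \<open>k\<close> with \<open>x\<^sub>k\<^sub>+\<^sub>1\<close> not inverted.\<close>

definition TP :: "nat \<Rightarrow> nat set \<Rightarrow> 'a set" where
  "TP i P = LR (\<sigma> i) {1..2*n} ({1..2*n} - P)"

text \<open>Interpolates between \<open>TP 0 P\<close> for \<open>k = 0\<close> and the lower bound
  algebra for \<open>k = n\<close> and empty \<open>P\<close>: inverses of x_1, ..., x_k are traded
  for projective variables.\<close>

definition AP :: "nat \<Rightarrow> nat set \<Rightarrow> 'a set" where
  "AP k P = subring_generated
     ({v, inverse v} \<union> x ` {1..2*n} \<union> (\<lambda>l. inverse (x l)) ` ({Suc k..2*n} - P) \<union> z ` {1..k})"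

lemma TP_subring [simp]: "is_subring (TP i P)" and AP_subring [simp]: "is_subring (AP k P)"
  by (simp_all add: TP_def AP_def)

lemma TP_scalars: "v \<in> TP i P" "inverse v \<in> TP i P"
  using LR_scalars by (auto simp: TP_def)

lemma TP_empty: "TP i {} = torus (\<sigma> i)"
  by (simp add: TP_def)

lemma TP_antimono: "P \<subseteq> Q \<Longrightarrow> TP i Q \<subseteq> TP i P"
  unfolding TP_def by (rule LR_mono) auto

lemma TP_cvar: "l \<in> {1..2*n} \<Longrightarrow> cvar (\<sigma> i) l \<in> TP i P"
  and TP_inverse_cvar: "l \<in> {1..2*n} \<Longrightarrow> l \<notin> P \<Longrightarrow> inverse (cvar (\<sigma> i) l) \<in> TP i P"
  unfolding TP_def by (rule cvar_LR, simp, rule inverse_cvar_LR, simp)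

lemma AP_base:
  "v \<in> AP k P" "inverse v \<in> AP k P" "l \<in> {1..2*n} \<Longrightarrow> x l \<in> AP k P"
  "l \<in> {Suc k..2*n} - P \<Longrightarrow> inverse (x l) \<in> AP k P" "l \<in> {1..k} \<Longrightarrow> z l \<in> AP k P"
  unfolding AP_def by (rule subring_generated_base, blast)+

text \<open>For l \<le> i the reverse exchange relation in \<open>\<sigma> l\<close> inverts only
  z_l; its other factors are z_p with p < l or x_p with p > l, hence the descending
  induction.\<close>

lemma x_TP:
  assumes i: "i \<le> n" and P: "P \<subseteq> {Suc i..2*n}" and l: "l \<in> {1..2*n}"
  shows "x l \<in> TP i P"
  using l
proof (induction l rule: measure_induct_rule[of "\<lambda>l. 2*n - l"])
  case (less l)
  show ?case
  proof (cases "l \<le> i")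
    case False
    then show ?thesis using TP_cvar[OF less.prems, of i P] by (simp add: cvar_iterated)
  next
    case True
    then obtain m where m: "l = Suc m" "m < n" using less.prems i by (cases l) auto
    have K: "Suc m \<in> {1..n}" using m by auto
    note g = good_iterated[OF less_imp_le[OF m(2)]]
    have "mon (\<sigma> l) (mvec (\<sigma> m) \<epsilon> (Suc m)) \<in> TP i P" for \<epsilon>
    proof (rule mon_in_subring)
      fix p assume p: "p \<in> {1..2*n}"
      show "cvar (\<sigma> l) p \<in> TP i P"
        using less.IH[of p] p TP_cvar[OF p, of i P] True
        by (cases "p \<le> l") (auto simp: cvar_iterated)
      assume "mvec (\<sigma> m) \<epsilon> (Suc m) p < 0"
      then have "p = l" using m mvec_off[OF g, of p "Suc m" \<epsilon>] by force
      then show "inverse (cvar (\<sigma> l) p) \<in> TP i P"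
        using TP_inverse_cvar[OF p, of P i] subsetD[OF P, of l] True p by (auto simp: cvar_iterated)
    qed (auto simp: TP_scalars)
    then show ?thesis
      using cvar_old[OF g K] m(1) by (simp add: cvar_iterated subring_add)
  qed
qed

text \<open>Mirror image of \<open>x_TP\<close>: for l > i, z_l is formed in the preceding seed,
  where only x_l is inverted, so the induction ascends. As l \<le> k, that inverse is
  available.\<close>

lemma z_TP:
  assumes i: "i \<le> k" and k: "k \<le> n" and P: "P \<subseteq> {Suc k..2*n}" and l: "l \<in> {1..k}"
  shows "z l \<in> TP i P"
  using l
proof (induction l rule: less_induct)
  case (less l)
  have l2: "l \<in> {1..2*n}" using less.prems k by auto
  show ?case
  proof (cases "l \<le> i")
    case True
    then show ?thesis using TP_cvar[OF l2, of i P] less.prems by (simp add: cvar_iterated)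
  next
    case False
    obtain m where m: "l = Suc m" "m < n" using less.prems k by (cases l) auto
    note g = good_iterated[OF less_imp_le[OF m(2)]]
    have "mon (\<sigma> m) (mvec (\<sigma> m) \<epsilon> (Suc m)) \<in> TP i P" for \<epsilon>
    proof (rule mon_in_subring)
      fix p assume p: "p \<in> {1..2*n}"
      show "cvar (\<sigma> m) p \<in> TP i P"
        using less.IH[of p] less.prems p TP_cvar[OF p, of i P] False m
        by (cases "p \<le> m") (auto simp: cvar_iterated)
      assume "mvec (\<sigma> m) \<epsilon> (Suc m) p < 0"
      then have "p = l" using m mvec_off[OF g, of p "Suc m" \<epsilon>] by force
      then show "inverse (cvar (\<sigma> m) p) \<in> TP i P"
        using TP_inverse_cvar[OF p, of P i] subsetD[OF P, of l] False m less.prems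
        by (auto simp: cvar_iterated)
    qed (auto simp: TP_scalars)
    then show ?thesis
      unfolding z_def m(1) by (simp add: cvar_mutate subring_add)
  qed
qed

lemma AP_subset_TP:
  assumes i: "i \<le> k" and k: "k \<le> n" and P: "P \<subseteq> {Suc k..2*n}"
  shows "AP k P \<subseteq> TP i P"
  unfolding AP_def
proof (rule subring_generated_minimal)
  have P': "P \<subseteq> {Suc i..2*n}" using P i by auto
  have "inverse (x l) \<in> TP i P" if "l \<in> {Suc k..2*n} - P" for l
    using TP_inverse_cvar[of l P i] that i by (simp add: cvar_iterated)
  then show "{v, inverse v} \<union> x ` {1..2*n} \<union> (\<lambda>l. inverse (x l)) ` ({Suc k..2*n} - P) \<union> z ` {1..k}
      \<subseteq> TP i P"
    using x_TP[OF le_trans[OF i k] P'] z_TP[OF i k P] TP_scalars by auto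
qed simp

lemma z_Suc:
  assumes i: "i < n"
  shows "z (Suc i) = inverse (x (Suc i)) + mon (\<sigma> i) (mvec (\<sigma> i) 1 (Suc i))"
proof -
  have K: "Suc i \<in> {1..2*n}" using i by auto
  note g = good_iterated[OF less_imp_le[OF i]]
  have "mon (\<sigma> i) (mvec (\<sigma> i) (- 1) (Suc i)) = mon (\<sigma> i) (\<lambda>l. - unit_vec (Suc i) l)"
    by (rule mon_cong) (simp_all add: mvec_iterated[OF i])
  also have "\<dots> = inverse (x (Suc i))"
    using mon_inverse[OF g, of "unit_vec (Suc i)"] mon_unit[OF K, of "\<sigma> i"]
    by (simp add: cvar_iterated)
  finally show ?thesis by (simp add: z_def cvar_mutate add.commute)
qed

text \<open>By \<open>z_Suc\<close>, z_(i+1) is the unit \<open>inverse (x (Suc i))\<close>, of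
  weight 0 for x_(i+1), plus a monomial of nonzero weight; so \<open>graded_cancel\<close> removes
  one factor at a time.\<close>

lemma z_TP_cancel:
  assumes i: "i < n" and P: "P \<subseteq> {Suc (Suc i)..2*n}"
    and f: "f \<in> TP i {}" "f * z (Suc i) ^ N \<in> TP i P"
  shows "f \<in> TP i P"
  using f
proof (induction N arbitrary: f)
  case (Suc N)
  let ?K = "Suc i"
  have K: "?K \<in> {1..n}" "?K \<in> {1..2*n}" "?K \<notin> P" using i P by auto
  note g = good_iterated[OF less_imp_le[OF i]]
  have xK: "cvar (\<sigma> i) ?K = x ?K" by (simp add: cvar_iterated)
  have "z ?K \<in> TP i {}" using z_TP[of i ?K "{}" ?K] i by auto
  then have "f * z ?K \<in> TP i {}" by (intro subring_mult TP_subring Suc.prems(1))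
  then have fz: "f * z ?K \<in> TP i P"
    by (rule Suc.IH) (use Suc.prems(2) in \<open>simp only: mult.assoc power_Suc\<close>)
  show ?case
  proof (rule graded_cancel)
    show "x ?K \<noteq> 0" "inverse (x ?K) \<noteq> 0" using good_nonzero[OF good_initial K(2)] by auto
    show "is_subring (TP i P)" by simp
    show "graded (x ?K) (TP i P)"
      unfolding TP_def xK[symmetric] by (rule graded_LR_cvar[OF g _ _ K(2)]) auto
    show "inverse (x ?K) \<in> TP i P" "inverse (inverse (x ?K)) \<in> TP i P"
      using TP_inverse_cvar[OF K(2,3), of i] TP_cvar[OF K(2), of i P] xK by auto
    show "mon (\<sigma> i) (mvec (\<sigma> i) 1 ?K) \<in> TP i P"
      unfolding TP_def
    proof (rule mon_LR)
      fix l assume "l \<in> {1..2*n}" "mvec (\<sigma> i) 1 ?K l < 0"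
      then show "l \<in> {1..2*n} - P" using mvec_off[OF g, of l ?K 1] K(3) by force
    qed
    show "inverse (x ?K) \<in> Wt (x ?K) 0"
      using Wt_inverse[of "x ?K" "x ?K" 0] by (simp add: Wt_iff)
    show "mon (\<sigma> i) (mvec (\<sigma> i) 1 ?K) \<in> Wt (x ?K) (2 * bil (\<sigma> i) (unit_vec ?K) (mvec (\<sigma> i) 1 ?K))"
      using mon_weight_cvar[OF g K(2)] xK by simp
    have "bil (\<sigma> i) (unit_vec ?K) (mvec (\<sigma> i) (-1) ?K) = bil (\<sigma> i) (unit_vec ?K) (\<lambda>l. - unit_vec ?K l)"
      by (rule bilin_cong) (simp_all add: mvec_iterated[OF i])
    then show "0 \<noteq> 2 * bil (\<sigma> i) (unit_vec ?K) (mvec (\<sigma> i) 1 ?K)"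
      using mvec_weights_differ[OF g K(1)] by (simp add: bilin_linear bilin_self[OF good_skew[OF g]])
    show "f \<in> hsums (Wt (x ?K))"
      using Suc.prems(1) graded_imp_hsums[OF graded_LR_cvar[OF g order_refl order_refl K(2)]]
      unfolding TP_empty xK by blast
    show "f * (inverse (x ?K) + mon (\<sigma> i) (mvec (\<sigma> i) 1 ?K)) \<in> TP i P"
      using fz unfolding z_Suc[OF i] .
  qed
qed simp

text \<open>A power of \<open>z (Suc i)\<close> clears its inverses and leads into a ring generated
  by elements of \<open>TP i P\<close>; \<open>z_TP_cancel\<close> then removes the power.\<close>

lemma TP_transfer_step:
  assumes i: "i < n" and P: "P \<subseteq> {Suc (Suc i)..2*n}" and f: "f \<in> TP (Suc i) P" "f \<in> TP i {}"
  shows "f \<in> TP i P"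
proof -
  let ?K = "Suc i"
  define I where "I = {1..2*n} - {?K}"
  define J where "J = {1..2*n} - P - {?K}"
  have K: "?K \<in> {1..n}" "?K \<in> {1..2*n}" "?K \<notin> P" using i P by auto
  have IJ: "{1..2*n} = insert ?K I" "{1..2*n} - P = insert ?K J" "I \<subseteq> {1..2*n}" "J \<subseteq> {1..2*n}"
    using K by (auto simp: I_def J_def)
  have g: "good (\<sigma> ?K)" using i by (intro good_iterated) auto
  have zK: "cvar (\<sigma> ?K) ?K = z ?K" by (simp add: z_def)
  have "f \<in> subring_generated (gens (\<sigma> ?K) I J \<union> {z ?K, inverse (z ?K)})"
    using f(1) unfolding TP_def LR_def gens_insert_both[of "\<sigma> ?K" ?K I J, unfolded zK, symmetric]
    by (simp only: IJ(1,2)[symmetric])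
  moreover have "\<exists>e. y \<in> Wt (z ?K) e" if "y \<in> gens (\<sigma> ?K) I J" for y
    using gens_weight_cvar[OF g IJ(3,4) that K(2)] zK by simp
  moreover have "z ?K \<noteq> 0" using good_nonzero[OF g K(2)] zK by simp
  ultimately obtain N where "f * z ?K ^ N \<in> subring_generated (insert (z ?K) (gens (\<sigma> ?K) I J))"
    using clear_denominators[OF gens_scalars] by blast
  moreover have "insert (z ?K) (gens (\<sigma> ?K) I J) \<subseteq> TP i P"
  proof -
    have "z ?K \<in> TP i P" by (rule z_TP[of i ?K]) (use i P in auto)
    moreover have "gens (\<sigma> ?K) I J = gens (\<sigma> i) I J"
      using gens_mutate[of ?K I J "\<sigma> i"] by (simp add: I_def J_def)
    moreover have "gens (\<sigma> i) I J \<subseteq> TP i P"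
      using gens_LR[of "\<sigma> i" I J] LR_mono[of I "{1..2*n}" J "{1..2*n} - P" "\<sigma> i"]
      unfolding TP_def by (auto simp: I_def J_def)
    ultimately show ?thesis by simp
  qed
  then have "subring_generated (insert (z ?K) (gens (\<sigma> ?K) I J)) \<subseteq> TP i P"
    by (rule subring_generated_minimal) simp
  ultimately show ?thesis using z_TP_cancel[OF i P f(2)] by blast
qed

text \<open>For an element of all the tori, absence of inverses of \<open>P\<close> thus need only
  be checked in the \<open>k\<close>-th one.\<close>

lemma TP_transfer:
  assumes k: "k \<le> n" and P: "P \<subseteq> {Suc k..2*n}"
    and f: "f \<in> TP k P" "\<And>i. i \<le> k \<Longrightarrow> f \<in> TP i {}" and i: "i \<le> k"
  shows "f \<in> TP i P"
  using i
proof (induction i rule: inc_induct)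
  case (step i)
  show ?case by (rule TP_transfer_step) (use step k P f(2) in auto)
qed (rule f(1))

end

section \<open>Clearing the pole along the variable of index \<open>Suc k\<close>\<close>

lemma (in central_parameter) hsums_shift:
  assumes "y \<noteq> 0" and f: "f * y ^ M \<in> hsums (\<lambda>m. if m \<ge> 0 then rank_one R y m else {0})"
  shows "f \<in> hsums (\<lambda>m. if m \<ge> - int M then rank_one R y m else {0})"
proof -
  obtain A g where A: "finite A" "\<And>m. g m \<in> (if m \<ge> 0 then rank_one R y m else {0})"
    "\<And>m. m \<notin> A \<Longrightarrow> g m = 0" "f * y ^ M = sum g A"
    using f unfolding hsums_def by blast
  define h where "h = (\<lambda>m. g (m + int M) * y powi (- int M))"
  have "f = f * y ^ M * y powi (- int M)" using assms(1) by (simp add: power_int_minus mult.assoc)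
  also have "\<dots> = (\<Sum>m\<in>A. g m * y powi (- int M))" unfolding A(4) by (rule sum_distrib_right)
  also have "\<dots> = sum h ((\<lambda>m. m - int M) ` A)"
    by (subst sum.reindex) (auto simp: inj_on_def h_def)
  finally have "f = sum h ((\<lambda>m. m - int M) ` A)" .
  moreover have "h m = 0" if "m \<notin> (\<lambda>m. m - int M) ` A" for m
  proof -
    have "m + int M \<notin> A"
      using that by (metis (no_types, lifting) add_diff_cancel_right' imageI)
    then show ?thesis by (simp add: h_def A(3))
  qed
  moreover have "h m \<in> (if m \<ge> - int M then rank_one R y m else {0})" for m
  proof (cases "m \<ge> - int M")
    case True
    then obtain r where r: "r \<in> R" "g (m + int M) = r * y powi (m + int M)"
      using A(2)[of "m + int M"] by (auto simp: rank_one_def)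
    have "y powi (m + int M) * y powi (- int M) = y powi (m + int M + - int M)"
      using assms(1) by (intro power_int_add[symmetric]) simp
    then have "h m = r * y powi m" unfolding h_def r(2) mult.assoc by simp
    then show ?thesis using True r(1) unfolding rank_one_def by auto
  next
    case False
    then show ?thesis using A(2)[of "m + int M"] by (simp add: h_def)
  qed
  ultimately show ?thesis
    using A(1) unfolding hsums_def mem_Collect_eq
    by (intro exI[of _ "(\<lambda>m. m - int M) ` A"] exI[of _ h]) simp
qed

context projective_setting
begin

lemma AP_insert_subset:
  assumes "k < n"
  shows "AP k (insert (Suc k) P) \<subseteq> AP (Suc k) P"
  unfolding AP_def by (rule subring_generated_mono) auto

text \<open>The ring \<open>coeffs k P\<close> consists of the coefficients of \<open>TP k P\<close> as a Laurent extension by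
  \<open>x\<^sub>k\<^sub>+\<^sub>1\<close>, and \<open>reductions k P\<close> is the image of \<open>AP k (insert (Suc k) P)\<close> under
  \<open>x\<^sub>k\<^sub>+\<^sub>1 \<mapsto> 0\<close>.\<close>

definition coeffs :: "nat \<Rightarrow> nat set \<Rightarrow> 'a set" where
  "coeffs k P = LR (\<sigma> k) ({1..2*n} - {Suc k}) ({1..2*n} - insert (Suc k) P)"

definition multiples :: "nat \<Rightarrow> nat set \<Rightarrow> 'a set" where
  "multiples k P = (\<lambda>h. h * x (Suc k)) ` TP k (insert (Suc k) P)"

definition reductions :: "nat \<Rightarrow> nat set \<Rightarrow> 'a set" where
  "reductions k P = {r \<in> coeffs k P. \<exists>g\<in>AP k (insert (Suc k) P). g - r \<in> multiples k P}"

context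
  fixes k :: nat and P :: "nat set"
  assumes k: "k < n" and P: "P \<subseteq> {Suc (Suc k)..2*n}"
begin

abbreviation (input) "K \<equiv> Suc k"
abbreviation (input) "S \<equiv> TP k (insert K P)"
abbreviation (input) "B \<equiv> AP k (insert K P)"
abbreviation (input) "R \<equiv> coeffs k P"
abbreviation (input) "J \<equiv> multiples k P"
abbreviation (input) "G \<equiv> gens (\<sigma> k) ({1..2*n} - {K}) ({1..2*n} - insert K P)"

lemma K_index: "K \<in> {1..n}" "K \<in> {1..2*n}" "K \<notin> P" "insert K P \<subseteq> {Suc k..2*n}"
  using k P by auto

lemma good_k: "good (\<sigma> k)" and good_K: "good (\<sigma> K)"
  using k good_iterated by (simp_all add: Suc_leI less_imp_le del: iterated_seed.simps)

lemma cvar_k_K: "cvar (\<sigma> k) K = x K" and cvar_K_K: "cvar (\<sigma> K) K = z K"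
  by (simp_all add: cvar_iterated z_def)

lemma x_nonzero: "x K \<noteq> 0"
  by (rule good_nonzero[OF good_initial K_index(2)])

lemma G_weight: "y \<in> G \<Longrightarrow> \<exists>e. y \<in> Wt (x K) e"
  using gens_weight_cvar[OF good_k _ _ _ K_index(2), of "{1..2*n} - {K}" "{1..2*n} - insert K P" y]
  unfolding cvar_k_K by blast

lemma S_eq: "S = subring_generated (insert (x K) G)"
proof -
  have "{1..2*n} = insert K ({1..2*n} - {K})" using K_index(2) by blast
  then show ?thesis
    unfolding TP_def LR_def by (metis gens_insert cvar_k_K)
qed

lemma R_subset_S: "R \<subseteq> S"
  unfolding coeffs_def TP_def by (rule LR_mono) auto

lemma B_subset_S: "B \<subseteq> S"
  by (rule AP_subset_TP) (use k K_index(4) in auto)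

lemma xK_in: "x K \<in> S" "x K \<in> B" "\<And>i. i \<le> k \<Longrightarrow> x K \<in> TP i P"
proof -
  show "x K \<in> S" using TP_cvar[OF K_index(2), of k] unfolding cvar_k_K .
  show "x K \<in> B" by (rule AP_base(3)[OF K_index(2)])
  show "x K \<in> TP i P" if "i \<le> k" for i
  proof (rule x_TP)
    show "P \<subseteq> {Suc i..2*n}" using P that by (meson Suc_le_mono atLeastatMost_subset_iff
      le_SucI order_refl subset_trans)
  qed (use that k K_index(2) in auto)
qed

lemma multiples_mult_left: "a \<in> S \<Longrightarrow> y \<in> J \<Longrightarrow> a * y \<in> J"
  unfolding multiples_def using subring_mult[OF TP_subring]
  by (auto simp flip: mult.assoc)

text \<open>\<open>x K\<close> is normal: conjugation by it preserves \<open>S\<close>, so the left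
  ideal \<open>J\<close> is two-sided and reduction modulo it is a ring map.\<close>

lemma multiples_mult_right:
  assumes a: "a \<in> S" and y: "y \<in> J"
  shows "y * a \<in> J"
proof -
  obtain h where h: "h \<in> S" "y = h * x K" using y by (auto simp: multiples_def)
  have "x K * a * inverse (x K) \<in> subring_generated (insert (x K) G)"
  proof (rule conj_closed)
    show "\<exists>e. y \<in> Wt (x K) e" if "y \<in> insert (x K) G" for y
    proof (cases "y = x K")
      case True
      then show ?thesis by (intro exI[of _ 0]) (simp add: Wt_iff)
    qed (use that G_weight in auto)
    show "a \<in> subring_generated (insert (x K) G)" using a unfolding S_eq .
  qed (use gens_scalars x_nonzero in auto)
  then have "h * (x K * a * inverse (x K)) \<in> S"
    unfolding S_eq[symmetric] by (rule subring_mult[OF TP_subring h(1)])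
  moreover have "y * a = h * (x K * a * inverse (x K)) * x K"
    using x_nonzero unfolding h(2) by (simp add: mult.assoc)
  ultimately show ?thesis unfolding multiples_def by blast
qed

lemma multiples_add_subgroup: "add_subgroup J"
  unfolding add_subgroup_def multiples_def
proof (intro conjI ballI)
  show "0 \<in> (\<lambda>h. h * x K) ` S" using subring_zero[OF TP_subring] by force
  fix a b assume "a \<in> (\<lambda>h. h * x K) ` S" "b \<in> (\<lambda>h. h * x K) ` S"
  then show "a - b \<in> (\<lambda>h. h * x K) ` S"
    using subring_diff[OF TP_subring] by (auto simp flip: left_diff_distrib)
qed

lemma R_subring: "is_subring R"
  by (simp add: coeffs_def)

lemma reductions_I: "r \<in> R \<Longrightarrow> r \<in> B \<Longrightarrow> r \<in> reductions k P"
  using multiples_add_subgroup by (auto simp: reductions_def add_subgroup_def intro!: bexI[of _ r])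

lemma reductions_subring: "is_subring (reductions k P)"
proof -
  have Jd: "\<And>a b. a \<in> J \<Longrightarrow> b \<in> J \<Longrightarrow> a - b \<in> J"
    using multiples_add_subgroup by (auto simp: add_subgroup_def)
  have "0 \<in> reductions k P" "1 \<in> reductions k P"
    by (intro reductions_I subring_zero subring_one R_subring AP_subring)+
  moreover have "r - r' \<in> reductions k P \<and> r * r' \<in> reductions k P"
    if r: "r \<in> reductions k P" and r': "r' \<in> reductions k P" for r r'
  proof -
    obtain g g' where g: "g \<in> B" "g - r \<in> J" "g' \<in> B" "g' - r' \<in> J" and R: "r \<in> R" "r' \<in> R"
      using r r' by (auto simp: reductions_def)
    have "(g - r) - (g' - r') \<in> J" by (rule Jd) (use g in auto)
    then have 1: "(g - g') - (r - r') \<in> J" by (simp add: algebra_simps)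
    have "g' \<in> S" "r \<in> S" using g(3) R(1) B_subset_S R_subset_S by auto
    then have "(g - r) * g' + r * (g' - r') \<in> J"
      using g by (intro add_subgroup_add[OF multiples_add_subgroup] multiples_mult_left multiples_mult_right)
    then have 2: "g * g' - r * r' \<in> J" by (simp add: algebra_simps)
    show ?thesis
      using 1 2 g R R_subring subring_diff[OF AP_subring] subring_mult[OF AP_subring]
      unfolding reductions_def by (blast intro: subring_diff subring_mult)
  qed
  ultimately show ?thesis by (simp add: is_subring_def)
qed

lemma scalars_reductions: "{v, inverse v} \<subseteq> reductions k P"
  using LR_scalars AP_base(1,2) unfolding coeffs_def[symmetric]
  by (auto intro!: reductions_I simp: coeffs_def)

lemma graded_B: "graded (x K) B"
  unfolding AP_def
proof (rule graded_subring_generated)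
  have x: "\<exists>e. x l \<in> Wt (x K) e" if "l \<in> {1..2*n}" for l
    using good_weight[OF good_initial K_index(2) that] by blast
  have z: "\<exists>e. z l \<in> Wt (x K) e" if "l \<in> {1..k}" for l
    using good_weight[OF good_k K_index(2), of l] that k by (auto simp: cvar_iterated)
  fix y assume "y \<in> {v, inverse v} \<union> x ` {1..2*n} \<union>
      (\<lambda>l. inverse (x l)) ` ({Suc k..2*n} - insert K P) \<union> z ` {1..k}"
  then have "y \<in> {v, inverse v} \<or> (\<exists>l\<in>{1..2*n}. y = x l) \<or> (\<exists>l\<in>{1..2*n}. y = inverse (x l))
      \<or> (\<exists>l\<in>{1..k}. y = z l)"
    by auto
  then show "\<exists>e. y \<in> Wt (x K) e"
    using Wt_scalar by (elim disjE bexE) (use x z Wt_inverse in blast)+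
qed

lemma graded_R: "graded (x K) R"
  using graded_LR_cvar[OF good_k _ _ K_index(2)] unfolding coeffs_def cvar_k_K by auto

lemma graded_multiples: "graded (x K) J"
  unfolding graded_def
proof
  fix y assume "y \<in> J"
  then obtain h where h: "h \<in> S" "y = h * x K" by (auto simp: multiples_def)
  have "graded (x K) S"
    using graded_LR_cvar[OF good_k _ _ K_index(2)] unfolding TP_def cvar_k_K by auto
  then obtain A g where A: "finite A" "\<And>m. g m \<in> S \<inter> Wt (x K) m" "h = sum g A"
    using h(1) unfolding graded_def hsums_def by blast
  have "y = (\<Sum>m\<in>A. g m * x K)" unfolding h(2) A(3) by (rule sum_distrib_right)
  also have "\<dots> \<in> hsums (\<lambda>e. J \<inter> Wt (x K) e)"
  proof (rule hsumsI[OF A(1)])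
    have w: "x K \<in> Wt (x K) 0" by (simp add: Wt_iff)
    show "g m * x K \<in> J \<inter> Wt (x K) m" for m
      using A(2)[of m] Wt_mult[OF _ w, of "g m" m] by (auto simp: multiples_def)
    show "0 \<in> J \<inter> Wt (x K) m" for m
      using multiples_add_subgroup Wt_add_subgroup by (auto simp: add_subgroup_def)
  qed
  finally show "y \<in> hsums (\<lambda>e. J \<inter> Wt (x K) e)" .
qed

text \<open>\<open>B\<close>, \<open>R\<close> and \<open>J\<close> are graded, so by uniqueness of
  components the weight \<open>m\<close> part of a witness \<open>g\<close> is a witness for the
  weight \<open>m\<close> part of \<open>r\<close>.\<close>

lemma graded_reductions: "graded (x K) (reductions k P)"
  unfolding graded_def
proof
  fix r assume r: "r \<in> reductions k P"
  then obtain g where g: "g \<in> B" "g - r \<in> J" "r \<in> R" by (auto simp: reductions_def)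
  obtain A r' where A: "finite A" "\<And>m. r' m \<in> R \<inter> Wt (x K) m" "\<And>m. m \<notin> A \<Longrightarrow> r' m = 0" "r = sum r' A"
    using subsetD[OF graded_R[unfolded graded_def] g(3)] unfolding hsums_def by blast
  obtain C g' where C: "finite C" "\<And>m. g' m \<in> B \<inter> Wt (x K) m" "\<And>m. m \<notin> C \<Longrightarrow> g' m = 0" "g = sum g' C"
    using subsetD[OF graded_B[unfolded graded_def] g(1)] unfolding hsums_def by blast
  obtain D h where D: "finite D" "\<And>m. h m \<in> J \<inter> Wt (x K) m" "\<And>m. m \<notin> D \<Longrightarrow> h m = 0" "g - r = sum h D"
    using subsetD[OF graded_multiples[unfolded graded_def] g(2)] unfolding hsums_def by blast
  have "g' m - r' m = h m" for m
  proof (rule Wt_unique[OF x_nonzero, of id "A \<union> C" D "\<lambda>m. g' m - r' m" h])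
    show "g' m - r' m \<in> Wt (x K) (id m)" for m
      using A(2)[of m] C(2)[of m] Wt_add_subgroup[of "x K" m] by (auto simp: add_subgroup_def)
    show "(\<Sum>m\<in>A \<union> C. g' m - r' m) = sum h D"
      using A C D(4) sum_zero_extend[of A "A \<union> C" r'] sum_zero_extend[of C "A \<union> C" g']
      by (simp add: sum_subtractf)
  qed (use A C D in auto)
  then have "g' m - r' m \<in> J" for m using D(2)[of m] by simp
  then have "r' m \<in> reductions k P \<inter> Wt (x K) m" for m
    using A(2)[of m] C(2)[of m] unfolding reductions_def by blast
  then show "r \<in> hsums (\<lambda>e. reductions k P \<inter> Wt (x K) e)"
    unfolding A(4) using A(1) subring_zero[OF reductions_subring] Wt_add_subgroup
    by (intro hsumsI) (auto simp: add_subgroup_def)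
qed

text \<open>The exchange column is nonnegative, so \<open>V\<close> uses no inverses and lies in
  \<open>B\<close> as well as in \<open>R\<close>. Its weight for \<open>x K\<close> is
  \<open>- 2 * d K\<close>.\<close>

lemma exchange_relation:
  obtains V e w where "z K * x K = 1 + V" "V \<in> R" "V \<in> reductions k P"
    "V \<in> Wt (z K) e" "V \<in> Wt (x K) w" "w \<noteq> 0"
proof -
  let ?b = "\<lambda>l. exch (\<sigma> k) l K"
  have b0: "?b K = 0" by (rule exch_diag[OF good_k K_index(1)])
  have mK: "mon (\<sigma> k) (unit_vec K) = x K" using mon_unit[OF K_index(2)] cvar_k_K by metis
  define c where "c = bil (\<sigma> k) (mvec (\<sigma> k) 1 K) (unit_vec K)"
  define V where "V = sc c (mon (\<sigma> k) ?b)"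
  have "mon (\<sigma> k) (\<lambda>l. mvec (\<sigma> k) 1 K l + unit_vec K l) = mon (\<sigma> k) ?b"
    by (rule mon_cong) (simp_all add: mvec_iterated(2)[OF k])
  then have "mon (\<sigma> k) (mvec (\<sigma> k) 1 K) * x K = V"
    unfolding mK[symmetric] mon_mult[OF good_k] V_def c_def by simp
  then have zx: "z K * x K = 1 + V"
    unfolding z_Suc[OF k] using x_nonzero by (simp add: distrib_right)
  have bR: "mon (\<sigma> k) ?b \<in> R"
    unfolding coeffs_def
  proof (rule mon_LR)
    fix l assume l: "l \<in> {1..2*n}"
    show "?b l > 0 \<Longrightarrow> l \<in> {1..2*n} - {K}" using l b0 by auto
    show "?b l < 0 \<Longrightarrow> l \<in> {1..2*n} - insert K P"
      using exch_iterated_nonneg[OF k l] by simp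
  qed
  have bB: "mon (\<sigma> k) ?b \<in> B"
  proof (rule mon_in_subring)
    fix l assume l: "l \<in> {1..2*n}"
    show "cvar (\<sigma> k) l \<in> B"
      using AP_base(3)[OF l] AP_base(5)[of l k] l by (auto simp: cvar_iterated)
    show "?b l < 0 \<Longrightarrow> inverse (cvar (\<sigma> k) l) \<in> B"
      using exch_iterated_nonneg[OF k l] by simp
  qed (auto simp: AP_base)
  have VR: "V \<in> R" unfolding V_def coeffs_def by (rule sc_LR) (rule bR[unfolded coeffs_def])
  have VB: "V \<in> B" unfolding V_def by (rule sc_in_subring) (use bB AP_base(1,2) in auto)
  have "mon (\<sigma> K) ?b = mon (\<sigma> k) ?b" using mon_off[of ?b K "\<sigma> k"] b0 by simp
  then have Vz: "V \<in> Wt (z K) (2 * bil (\<sigma> K) (unit_vec K) ?b)"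
    using mon_weight_cvar[OF good_K K_index(2), of ?b] cvar_K_K unfolding V_def by (metis Wt_sc)
  have Vx: "V \<in> Wt (x K) (2 * bil (\<sigma> k) (unit_vec K) ?b)"
    using mon_weight_cvar[OF good_k K_index(2), of ?b] cvar_k_K unfolding V_def by (metis Wt_sc)
  have "bil (\<sigma> k) (unit_vec K) ?b = - d K"
    using bil_exch[OF good_k K_index(1), of "unit_vec K"]
      bilin_skew[OF good_skew[OF good_k], of "unit_vec K" ?b] by (simp add: unit_vec_def)
  then have "2 * bil (\<sigma> k) (unit_vec K) ?b \<noteq> 0" using d_pos[OF K_index(1)] by simp
  then show thesis using that[OF zx VR reductions_I[OF VR VB] Vz Vx] by blast
qed

text \<open>Insert \<open>z K * x K = 1 + V\<close> in the middle of the product; moving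
  \<open>1 + V\<close> left past \<open>z K ^ M\<close> only multiplies \<open>V\<close> by a power
  of \<open>v\<close>.\<close>

lemma z_power_x_power: "\<exists>c\<in>R. z K ^ Suc M * x K ^ Suc M = (1 + c) * (z K ^ M * x K ^ M)
    \<and> c \<in> reductions k P \<and> (\<exists>w. w \<noteq> 0 \<and> c \<in> Wt (x K) w)"
proof -
  obtain V e w where V: "z K * x K = 1 + V" "V \<in> R" "V \<in> reductions k P"
    "V \<in> Wt (z K) e" "V \<in> Wt (x K) w" "w \<noteq> 0"
    by (rule exchange_relation)
  define c where "c = sc (int M * e) V"
  have "V \<in> Wt (z K ^ M) (int M * e)" using Wt_power_left[OF V(4), of "int M"] by simp
  then have "z K ^ M * V = c * z K ^ M" by (simp add: Wt_iff c_def)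
  then have "z K ^ M * (1 + V) = (1 + c) * z K ^ M" by (simp add: algebra_simps)
  moreover have "z K ^ Suc M * x K ^ Suc M = z K ^ M * (z K * x K) * x K ^ M"
    by (simp only: power_Suc2[of "z K"] power_Suc[of "x K"] mult.assoc)
  ultimately have "z K ^ Suc M * x K ^ Suc M = (1 + c) * (z K ^ M * x K ^ M)"
    unfolding V(1) by (simp only: mult.assoc)
  moreover have "c \<in> R" unfolding c_def coeffs_def by (rule sc_LR) (rule V(2)[unfolded coeffs_def])
  moreover have "c \<in> reductions k P"
    unfolding c_def by (rule sc_in_subring[OF reductions_subring scalars_reductions V(3)])
  moreover have "c \<in> Wt (x K) w" unfolding c_def by (rule Wt_sc[OF V(5)])
  ultimately show ?thesis using V(6) by blast
qed

lemma z_power_x_power_coeffs: "z K ^ M * x K ^ M \<in> R"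
proof (induction M)
  case (Suc M)
  then show ?case using z_power_x_power[of M] R_subring
    by (metis subring_add subring_mult subring_one)
qed (simp add: subring_one R_subring)

text \<open>The factors \<open>1 + c\<close> go one at a time by \<open>graded_cancel\<close>, with
  \<open>1\<close> as the unit: it has weight 0 for \<open>x K\<close>, while \<open>c\<close> has
  nonzero weight.\<close>

lemma cancel_z_power:
  "r \<in> R \<Longrightarrow> r * (z K ^ M * x K ^ M) \<in> reductions k P \<Longrightarrow> r \<in> reductions k P"
proof (induction M arbitrary: r)
  case (Suc M)
  obtain c w where c: "c \<in> R" "z K ^ Suc M * x K ^ Suc M = (1 + c) * (z K ^ M * x K ^ M)"
    "c \<in> reductions k P" "w \<noteq> 0" "c \<in> Wt (x K) w"
    using z_power_x_power by blast
  have one: "1 \<in> reductions k P" by (rule subring_one[OF reductions_subring])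
  have rc: "r * (1 + c) \<in> reductions k P"
  proof (rule Suc.IH)
    show "r * (1 + c) \<in> R" using Suc.prems(1) c(1) R_subring
      by (intro subring_mult subring_add subring_one)
    show "r * (1 + c) * (z K ^ M * x K ^ M) \<in> reductions k P"
      using Suc.prems(2) unfolding c(2) by (simp only: mult.assoc)
  qed
  show ?case
    by (rule graded_cancel[OF x_nonzero reductions_subring graded_reductions one _ _ Wt_one c(3,5)])
      (use rc one c(4) Suc.prems(1) graded_imp_hsums[OF graded_R] in auto)
qed simp

text \<open>Compare the expansion of \<open>f\<close> in \<open>x K\<close>, with pole order at most
  \<open>M\<close>, with that in \<open>z K\<close>: the component of degree \<open>- M\<close> is
  \<open>r * z K ^ M\<close>, and each higher one becomes right-divisible by \<open>x K\<close> when
  multiplied by \<open>x K ^ M\<close>.\<close>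

lemma lowest_coefficient:
  assumes f: "f \<in> TP k P" "f \<in> TP K P" "f * x K ^ M \<in> S"
  shows "\<exists>r\<in>R. f * x K ^ M - r * (z K ^ M * x K ^ M) \<in> J"
proof -
  let ?H = "\<lambda>m. if m \<ge> - int M then rank_one R (x K) m else {0}"
  let ?H' = "\<lambda>m. rank_one R (z K) (- m)"
  let ?I = "{1..2*n} - {K}" let ?J = "{1..2*n} - insert K P"
  have I: "?I \<subseteq> {1..2*n} - {K}" "?J \<subseteq> {1..2*n} - {K}" by auto
  have sets: "{1..2*n} = insert K ?I" "{1..2*n} - P = insert K ?J"
    using K_index(2,3) by auto
  have R: "subring_generated G = R" by (simp add: coeffs_def LR_def)
  have zK: "cvar (mutate n v K (\<sigma> k)) K = z K" using cvar_K_K by simp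
  have Z: "0 \<in> rank_one R y m" for y m by (rule zero_rank_one[OF R_subring])
  have "S \<subseteq> hsums (\<lambda>m. if m \<ge> 0 then rank_one R (x K) m else {0})"
    unfolding S_eq R[symmetric] by (rule polynomial_extension[OF gens_scalars G_weight x_nonzero])
  then have "f * x K ^ M \<in> hsums (\<lambda>m. if m \<ge> 0 then rank_one R (x K) m else {0})"
    using f(3) by blast
  then have 1: "f \<in> hsums ?H" by (rule hsums_shift[OF x_nonzero])
  have "f \<in> LR (\<sigma> K) (insert K ?I) (insert K ?J)"
    using f(2) unfolding TP_def sets(2) sets(1)[symmetric] .
  then have 2: "f \<in> hsums ?H'"
    using mutated_decomposition[OF good_k K_index(1) I, of f] zK by (simp add: coeffs_def)
  have "hsums ?H \<inter> hsums ?H' \<subseteq> hsums (\<lambda>m. ?H m \<inter> ?H' m)"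
  proof (rule exchange_Int[OF good_k K_index(1) I])
    show "?H m \<subseteq> rank_one (LR (\<sigma> k) ?I ?J) (cvar (\<sigma> k) K) m" for m
      using Z[of "x K" m] unfolding cvar_k_K coeffs_def by auto
    show "?H' m \<subseteq> rank_one (LR (\<sigma> k) ?I ?J) (cvar (mutate n v K (\<sigma> k)) K) (- m)" for m
      unfolding zK coeffs_def by simp
  qed
  then have "f \<in> hsums (\<lambda>m. ?H m \<inter> ?H' m)" using 1 2 by blast
  then obtain A g where A: "finite A" "\<And>m. g m \<in> ?H m \<inter> ?H' m" "\<And>m. m \<notin> A \<Longrightarrow> g m = 0" "f = sum g A"
    unfolding hsums_def by blast
  obtain r where r: "r \<in> R" "g (- int M) = r * z K ^ M"
    using A(2)[of "- int M"] by (auto simp: rank_one_def)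
  \<comment> \<open>Degree \<open>- M\<close> may be missing from the support \<open>A\<close>; it
    is added so that it can be split off.\<close>
  let ?A = "insert (- int M) A"
  have "f = sum g ?A" unfolding A(4) using A(1,3) by (intro sum_zero_extend[symmetric]) auto
  also have "\<dots> = g (- int M) + sum g (?A - {- int M})"
    using A(1) by (intro sum.remove) auto
  finally have "f * x K ^ M - r * (z K ^ M * x K ^ M) = (\<Sum>m\<in>?A - {- int M}. g m * x K ^ M)"
    unfolding r(2) by (simp add: distrib_right sum_distrib_right mult.assoc)
  also have "\<dots> \<in> J"
  proof (rule add_subgroup_sum[OF multiples_add_subgroup])
    fix m assume m: "m \<in> ?A - {- int M}"
    show "g m * x K ^ M \<in> J"
    proof (cases "m > - int M")
      case True
      then obtain \<rho> where \<rho>: "\<rho> \<in> R" "g m = \<rho> * x K powi m"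
        using A(2)[of m] by (auto simp: rank_one_def)
      have "x K powi m * x K ^ M = x K powi (m + int M)"
        using x_nonzero by (simp only: power_int_add power_int_of_nat simp_thms)
      also have "\<dots> = x K powi int (Suc (nat (m + int M - 1)))" using True by simp
      also have "\<dots> = x K ^ nat (m + int M - 1) * x K"
        unfolding power_int_of_nat by (rule power_Suc2)
      finally have "g m * x K ^ M = (\<rho> * x K ^ nat (m + int M - 1)) * x K"
        unfolding \<rho>(2) by (simp only: mult.assoc)
      moreover have "\<rho> * x K ^ nat (m + int M - 1) \<in> S"
        using \<rho>(1) R_subset_S xK_in(1) by (intro subring_mult subring_power TP_subring) auto
      ultimately show ?thesis unfolding multiples_def by blast
    next
      case False
      then have "g m = 0" using A(2)[of m] m by auto
      then show ?thesis using multiples_add_subgroup by (simp add: add_subgroup_def)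
    qed
  qed
  finally show ?thesis using r(1) by blast
qed

text \<open>\<open>IH\<close> is the outer induction hypothesis with \<open>x K\<close> no longer
  inverted; \<open>M\<close> bounds the pole of \<open>f\<close> along \<open>x K\<close>.\<close>

lemma pole_reduction:
  assumes IH: "\<And>f. (\<And>i. i \<le> k \<Longrightarrow> f \<in> TP i (insert K P)) \<Longrightarrow> f \<in> B"
    and f: "\<And>i. i \<le> K \<Longrightarrow> f \<in> TP i P" "f * x K ^ M \<in> S"
  shows "f \<in> AP K P"
  using f
proof (induction M arbitrary: f)
  case 0
  have "f \<in> TP i (insert K P)" if "i \<le> k" for i
  proof (rule TP_transfer[OF less_imp_le[OF k] K_index(4) _ _ that])
    show "f \<in> TP k (insert K P)" using 0(2) by simp
    show "f \<in> TP i {}" if "i \<le> k" for i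
      using 0(1)[of i] TP_antimono[of "{}" P i] that by auto
  qed
  then show ?case using IH AP_insert_subset[OF k] by blast
next
  case (Suc M)
  have Kn: "K \<le> n" using k by simp
  let ?g = "f * x K ^ Suc M"
  have gT: "?g \<in> TP i P" if "i \<le> k" for i
    using Suc.prems(1)[of i] xK_in(3)[OF that] that by (intro subring_mult subring_power TP_subring) auto
  have "?g \<in> TP i (insert K P)" if "i \<le> k" for i
    by (rule TP_transfer[OF less_imp_le[OF k] K_index(4) Suc.prems(2) _ that])
      (rule subsetD[OF TP_antimono gT], simp)
  then have gB: "?g \<in> B" by (rule IH)
  obtain r where r: "r \<in> R" "?g - r * (z K ^ Suc M * x K ^ Suc M) \<in> J"
    using lowest_coefficient[OF Suc.prems(1)[of k] Suc.prems(1)[of K] Suc.prems(2)] by auto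
  have zxR: "z K ^ Suc M * x K ^ Suc M \<in> R" by (rule z_power_x_power_coeffs)
  \<comment> \<open>The witness is \<open>?g\<close>, which lies in \<open>B\<close> by the outer
    hypothesis.\<close>
  have "r * (z K ^ Suc M * x K ^ Suc M) \<in> reductions k P"
    unfolding reductions_def using r gB zxR subring_mult[OF R_subring] by blast
  then have "r \<in> reductions k P" by (rule cancel_z_power[OF r(1)])
  then obtain h where h: "h \<in> B" "h - r \<in> J" by (auto simp: reductions_def)
  \<comment> \<open>\<open>h\<close> has the same reduction as the lowest coefficient
    \<open>r\<close>, so the pole of order \<open>Suc M\<close> cancels.\<close>
  define f' where "f' = f - h * z K ^ Suc M"
  have hA: "h * z K ^ Suc M \<in> AP K P"
    using subsetD[OF AP_insert_subset[OF k] h(1)] AP_base(5)[of K K P]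
    by (intro subring_mult subring_power AP_subring) auto
  have "f' \<in> AP K P"
  proof (rule Suc.IH)
    show "f' \<in> TP i P" if "i \<le> K" for i
      unfolding f'_def
      by (intro subring_diff TP_subring Suc.prems(1) that subsetD[OF AP_subset_TP[OF that Kn P] hA])
    have "(h - r) * (z K ^ Suc M * x K ^ Suc M) \<in> J"
      using zxR R_subset_S by (intro multiples_mult_right h(2)) auto
    then have "(?g - r * (z K ^ Suc M * x K ^ Suc M)) - (h - r) * (z K ^ Suc M * x K ^ Suc M) \<in> J"
      using r(2) multiples_add_subgroup unfolding add_subgroup_def by blast
    moreover have "(?g - r * (z K ^ Suc M * x K ^ Suc M)) - (h - r) * (z K ^ Suc M * x K ^ Suc M)
        = f' * x K ^ Suc M"
      unfolding f'_def left_diff_distrib by (simp only: mult.assoc) simp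
    ultimately obtain p where p: "p \<in> S" "f' * x K ^ Suc M = p * x K"
      by (auto simp: multiples_def)
    \<comment> \<open>Membership in \<open>J\<close> supplies a right factor \<open>x K\<close>;
      cancelling it lowers the exponent to \<open>M\<close>.\<close>
    have "f' * x K ^ M * x K = p * x K" using p(2) unfolding power_Suc2 by (simp only: mult.assoc)
    then show "f' * x K ^ M \<in> S" using x_nonzero p(1) by simp
  qed
  then have "f' + h * z K ^ Suc M \<in> AP K P" using hA by (intro subring_add AP_subring)
  then show ?case by (simp add: f'_def)
qed

end

section \<open>The intersection of the tori and the lower bound algebra\<close>

lemma torus_intersection:
  assumes "k \<le> n" "P \<subseteq> {Suc k..2*n}" "\<And>i. i \<le> k \<Longrightarrow> f \<in> TP i P"
  shows "f \<in> AP k P"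
  using assms
proof (induction k arbitrary: P f)
  case 0
  \<comment> \<open>For \<open>k = 0\<close> the two rings have the same generators.\<close>
  have "gens (\<sigma> 0) {1..2*n} ({1..2*n} - P)
      = {v, inverse v} \<union> x ` {1..2*n} \<union> (\<lambda>l. inverse (x l)) ` ({Suc 0..2*n} - P) \<union> z ` {1..0}"
    by (simp add: gens_def)
  then show ?case using 0(3)[of 0] by (simp add: TP_def AP_def LR_def)
next
  case (Suc k)
  have k: "k < n" and P: "P \<subseteq> {Suc (Suc k)..2*n}" using Suc.prems by auto
  have K: "Suc k \<in> {1..2*n}" "Suc k \<notin> P" using k P by auto
  let ?I = "{1..2*n} - {Suc k}" let ?J = "{1..2*n} - insert (Suc k) P"
  have sets: "{1..2*n} = insert (Suc k) ?I" "{1..2*n} - P = insert (Suc k) ?J"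
    using K by auto
  have "f \<in> LR (\<sigma> k) (insert (Suc k) ?I) (insert (Suc k) ?J)"
    using Suc.prems(3)[of k] unfolding TP_def sets(2) sets(1)[symmetric] by simp
  then have "f \<in> subring_generated (gens (\<sigma> k) ?I ?J \<union> {x (Suc k), inverse (x (Suc k))})"
    unfolding LR_def gens_insert_both cvar_k_K[OF k P] .
  then obtain M where "f * x (Suc k) ^ M \<in> TP k (insert (Suc k) P)"
    using clear_denominators[OF gens_scalars G_weight[OF k P] x_nonzero[OF k P]]
    unfolding S_eq[OF k P] by blast
  \<comment> \<open>The induction hypothesis is used with \<open>Suc k\<close> added to
    \<open>P\<close>.\<close>
  then show ?case
    by (intro pole_reduction[OF k P _ Suc.prems(3)] Suc.IH) (use k P K in auto)
qed

lemma cluster_algebra_eq_lower_bound: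
  "quantum_cluster_algebra n v s = lower_bound_algebra n v s"
proof
  let ?L = "lower_bound_algebra n v s"
  have L: "is_subring ?L" by (simp add: lower_bound_algebra_def)
  have proj: "projective_variable n v s l = z l" if "l \<in> {1..n}" for l
    using that by (simp add: projective_variable_def cvar_iterated)
  have ZPL: "ZP n v s \<subseteq> ?L"
    unfolding lower_bound_algebra_def by (auto intro: subring_generated_base)
  have ZPg: "v \<in> ?L" "inverse v \<in> ?L"
    "\<And>l. l \<in> {n+1..2*n} \<Longrightarrow> x l \<in> ?L" "\<And>l. l \<in> {n+1..2*n} \<Longrightarrow> inverse (x l) \<in> ?L"
    by (rule subsetD[OF ZPL], unfold ZP_def, rule subring_generated_base, blast)+
  have xL: "x l \<in> ?L" if "l \<in> {1..n}" for l
    unfolding lower_bound_algebra_def using that by (auto intro: subring_generated_base)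
  have zL: "z l \<in> ?L" if "l \<in> {1..n}" for l
    unfolding proj[OF that, symmetric] lower_bound_algebra_def using that
    by (auto intro: subring_generated_base)
  have AL: "AP n {} \<subseteq> ?L"
    unfolding AP_def
  proof (rule subring_generated_minimal[OF _ L])
    have "x l \<in> ?L" if "l \<in> {1..2*n}" for l
      using that xL[of l] ZPg(3)[of l] by (cases "l \<le> n") auto
    then show "{v, inverse v} \<union> x ` {1..2*n} \<union> (\<lambda>l. inverse (x l)) ` ({Suc n..2*n} - {}) \<union> z ` {1..n} \<subseteq> ?L"
      using ZPg zL by auto
  qed
  have "cvar t i \<in> ?L" if t: "t \<in> mutation_class n v s" and i: "i \<in> {1..n}" for t i
  proof -
    have "cvar t i \<in> TP m {}" if "m \<le> n" for m
    proof -
      \<comment> \<open>\<open>upper\<close> is constant on the mutation class, so a cluster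
        variable of \<open>t\<close> lies in the torus of each \<open>\<sigma> m\<close>.\<close>
      have "cvar t i \<in> upper t"
        using mutation_class_upper[OF good_initial t] cvar_upper unit_vec_in[OF i] by blast
      also have "upper t = upper (\<sigma> m)"
        using mutation_class_upper[OF good_initial t]
          mutation_class_upper[OF good_initial iterated_in_class[OF that]] by simp
      finally show ?thesis by (simp add: upper_def TP_empty)
    qed
    then have "cvar t i \<in> AP n {}" by (intro torus_intersection) auto
    then show ?thesis using AL by blast
  qed
  then show "quantum_cluster_algebra n v s \<subseteq> ?L"
    unfolding quantum_cluster_algebra_def
    by (intro subring_generated_minimal L) (use ZPL in auto)
  show "?L \<subseteq> quantum_cluster_algebra n v s"
    unfolding lower_bound_algebra_def quantum_cluster_algebra_def
    by (rule subring_generated_mono)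
      (use iterated_in_class[OF order_refl] mutation_class.base[of s n v] in
        \<open>auto simp: projective_variable_def\<close>)
qed

end

section \<open>The given skew-field and seed satisfy the abstract setting\<close>

lemma (in quantum_torus_skew_field) v_power_int_independent: "v \<noteq> 0" "v powi k = 1 \<Longrightarrow> k = 0"
proof -
  show "v \<noteq> 0" using v_indeterminate[of "{1}" "\<lambda>_. 1"] by auto
  assume k: "v powi k = 1"
  show "k = 0"
  proof (rule ccontr)
    assume "k \<noteq> 0"
    \<comment> \<open>Otherwise \<open>v powi k - 1\<close> is a vanishing Laurent polynomial with
      nonzero coefficients.\<close>
    then show False
      using v_indeterminate[of "{0, k}" "\<lambda>j. if j = 0 then - 1 else 1"] k by auto
  qed
qed

text \<open>The centralizer of \<open>v\<close> is a subring closed under inverses and contains the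
  quantum torus, hence all fractions.\<close>

lemma (in quantum_torus_skew_field) v_commutes: "v * y = y * v"
proof -
  let ?C = "{y. v * y = y * v}"
  have v0: "v \<noteq> 0" by (rule v_power_int_independent)
  have inv: "inverse y \<in> ?C" if "y \<in> ?C" for y
  proof (cases "y = 0")
    case False
    have "v * inverse y = inverse y * (y * v) * inverse y" using False by (simp flip: mult.assoc)
    also have "\<dots> = inverse y * (v * y) * inverse y" using that by simp
    also have "\<dots> = inverse y * v" using False by (simp add: mult.assoc)
    finally show ?thesis by simp
  qed simp
  have C: "is_subring ?C"
    by (auto simp: is_subring_def algebra_simps) (metis mult.assoc)
  have "laurent_scalars v \<subseteq> ?C"
    unfolding laurent_scalars_def by (rule subring_generated_minimal[OF _ C]) (use v0 in auto)
  then have "quantum_torus m v X \<subseteq> ?C"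
    unfolding quantum_torus_def
    by (auto intro!: add_subgroup_sum[OF subring_add_subgroup[OF C], simplified]
        subring_mult[OF C, simplified] simp: v_central subset_iff image_iff)
  moreover obtain p r where "p \<in> quantum_torus m v X" "r \<in> quantum_torus m v X" "y = p * inverse r"
    using fractions by blast
  ultimately have "y \<in> ?C" using inv subring_mult[OF C] by blast
  then show ?thesis by simp
qed

lemma (in quantum_torus_skew_field) X_nonzero:
  assumes "a \<in> int_vecs m"
  shows "X a \<noteq> 0"
proof
  assume "X a = 0"
  moreover have "(\<lambda>_. 1) ` {a} \<subseteq> laurent_scalars v"
    by (simp add: laurent_scalars_def subring_one)
  ultimately show False using X_indep[of "{a}" "\<lambda>_. 1"] assms by auto
qed

theorem theorem3p6:
  fixes n :: nat and d :: "nat \<Rightarrow> int"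
    and v :: "'a::division_ring" and X :: "(nat \<Rightarrow> int) \<Rightarrow> 'a" and s :: "'a seed"
  assumes "quantum_seed n d v X s"
    and "principal_coefficients n (exch s)"
    and "acyclic_seed n s"
    and "\<And>i j. i \<in> {1..n} \<Longrightarrow> j \<in> {1..n} \<Longrightarrow> i > j \<Longrightarrow> exch s i j \<ge> 0"
  shows "quantum_cluster_algebra n v s = lower_bound_algebra n v s"
proof -
  interpret Q: quantum_torus_skew_field "2*n" "form s" v X
    using assms(1) by (simp add: quantum_seed_def)
  interpret mutation_setting v n d
    by unfold_locales
      (use assms(1) Q.v_power_int_independent Q.v_commutes in
        \<open>auto simp: quantum_seed_def skew_symmetrizer_def\<close>)
  have sk: "skew_symmetric (2*n) (form s)" and cv: "\<And>i. i \<in> {1..2*n} \<Longrightarrow> cvar s i = X (unit_vec i)"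
    using assms(1) by (auto simp: quantum_seed_def)
  have u: "unit_vec i \<in> int_vecs (2*n)" if "i \<in> {1..2*n}" for i
    using that by (auto simp: int_vecs_def unit_vec_def)
  have "good s"
    unfolding good_def
  proof (intro conjI ballI sk)
    show "compatible_pair n d (form s) (exch s)" using assms(1) by (simp add: quantum_seed_def)
    show "cvar s i \<noteq> 0" if "i \<in> {1..2*n}" for i
      using Q.X_nonzero[OF u[OF that]] cv[OF that] by simp
    fix i j assume i: "i \<in> {1..2*n}" and j: "j \<in> {1..2*n}"
    \<comment> \<open>Both products are multiples of one basis element by opposite powers of
      \<open>v\<close>, whence the factor 2 in \<open>good\<close>.\<close>
    have "X (unit_vec i) * X (unit_vec j) = sc (form s i j) (X (\<lambda>l. unit_vec i l + unit_vec j l))"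
      "X (unit_vec j) * X (unit_vec i) = sc (form s j i) (X (\<lambda>l. unit_vec i l + unit_vec j l))"
      using Q.X_mult[OF u[OF i] u[OF j]] Q.X_mult[OF u[OF j] u[OF i]] i j
      by (simp_all only: bilin_unit_unit sc_def add.commute)
    moreover have "form s j i = - form s i j" using sk i j unfolding skew_symmetric_def by blast
    ultimately show "cvar s j \<in> Wt (cvar s i) (2 * form s i j)"
      by (simp add: Wt_iff cv[OF i] cv[OF j])
  qed
  then interpret projective_setting v n d s
    by unfold_locales (use assms in auto)
  show ?thesis by (rule cluster_algebra_eq_lower_bound)
qed

end
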